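(* Let $\Delta$ be a simplicial forest on the vertex set $[n]$ with facets $F_1,\dots,F_r$, listed in a good leaf ordering. Let $R=\mathsf{k}[x_1,\dots,x_n]$ over a field $\mathsf{k}$, $m_i=\prod_{j\in F_i}x_j$ and $d_i=\deg(m_i)$ for $1\le i\le r$, and for $1\le i\le r-1$ let $\Delta_i=\langle F_1,\dots,F_i\rangle$ and $J_i=(m_{i+1},\dots,m_r)$. Then for all $s\ge1$, $$\mathrm{reg}\left(\frac{R}{I(\Delta)^{s+1}}\right)\le\max\left\{d_r+\mathrm{reg}\left(\frac{R}{I(\Delta)^s}\right),\ \max_{1\le i\le r-1}\left\{d_i+\mathrm{reg}\left(\frac{R}{I(\Delta_i)^s+(J_i:m_i)}\right)\right\},\ \mathrm{reg}\left(\frac{R}{I(\Delta)}\right)\right\}.$$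
   Context: A simplicial complex on $[n]=\{1,\dots,n\}$ is a collection of subsets containing all singletons and closed under taking subsets; facets are maximal faces; $\langle F_1,\dots,F_i\rangle$ denotes the simplicial complex with facets $F_1,\dots,F_i$. The facet ideal is $I(\langle F_1,\dots,F_i\rangle)=(m_1,\dots,m_i)\subset R$. A facet $F$ is a leaf if it is the only facet, or there is a facet $G\ne F$ with $H\cap F\subseteq G\cap F$ for all facets $H\ne F$. $\Delta$ is a simplicial forest if every subcomplex generated by a nonempty set of facets of $\Delta$ has a leaf. A good leaf is a facet $F$ that is a leaf of every subcomplex generated by a set of facets containing $F$; equivalently, $\{F\cap G: G\text{ a facet}\}$ is totally ordered by inclusion. An ordering $F_1,\dots,F_r$ of the facets is a good leaf ordering if $F_i$ is a good leaf of $\langle F_1,\dots,F_i\rangle$ for every $2\le i\le r$. (A simplicial complex is a simplicial forest if and only if its facets admit a good leaf ordering.) $\mathrm{reg}$ denotes Castelnuovo–Mumford regularity. If $r=1$ the inner maximum is over the empty set and is omitted. *)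

theory Defs
  imports Complex_Main "HOL-Library.Poly_Mapping" "HOL-Library.Extended_Real"
begin

section \<open>The polynomial ring\<close>

text \<open>
  The vertex set \<open>[n]\<close> is rendered as a finite type \<open>'v\<close> with \<open>n\<close> elements, and
  \<open>R = k[x\<^sub>1, \<dots>, x\<^sub>n]\<close> as the monoid algebra of the monoid of exponent vectors
  \<open>'v \<Rightarrow>\<^sub>0 nat\<close>; its ring operations are the instances from \<open>Poly_Mapping\<close>.
\<close>

type_synonym ('v, 'k) mpoly = "('v \<Rightarrow>\<^sub>0 nat) \<Rightarrow>\<^sub>0 'k"

definition var :: "'v \<Rightarrow> ('v, 'k::field) mpoly" where
  "var v = Poly_Mapping.single (Poly_Mapping.single v 1) 1"

definition mon_deg :: "('v::finite \<Rightarrow>\<^sub>0 nat) \<Rightarrow> nat" where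
  "mon_deg t = (\<Sum>v\<in>UNIV. Poly_Mapping.lookup t v)"

definition total_degree :: "('v::finite, 'k::field) mpoly \<Rightarrow> nat" where
  "total_degree p = (if p = 0 then 0 else Max (mon_deg ` Poly_Mapping.keys p))"

definition homogeneous :: "nat \<Rightarrow> ('v::finite, 'k::field) mpoly \<Rightarrow> bool" where
  "homogeneous j p \<longleftrightarrow> (\<forall>t\<in>Poly_Mapping.keys p. mon_deg t = j)"


section \<open>Operations on ideals\<close>

definition ideal_gen :: "'a::comm_ring_1 set \<Rightarrow> 'a set" where
  "ideal_gen S = module.span (*) S"

definition ideal_sum :: "'a::comm_ring_1 set \<Rightarrow> 'a set \<Rightarrow> 'a set" where
  "ideal_sum I J = {a + b | a b. a \<in> I \<and> b \<in> J}"

definition ideal_prod :: "'a::comm_ring_1 set \<Rightarrow> 'a set \<Rightarrow> 'a set" where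
  "ideal_prod I J = ideal_gen {a * b | a b. a \<in> I \<and> b \<in> J}"

primrec ideal_power :: "'a::comm_ring_1 set \<Rightarrow> nat \<Rightarrow> 'a set" where
  "ideal_power I 0 = UNIV"
| "ideal_power I (Suc s) = ideal_prod I (ideal_power I s)"

definition ideal_colon :: "'a::comm_ring_1 set \<Rightarrow> 'a \<Rightarrow> 'a set" where
  "ideal_colon I f = {g. g * f \<in> I}"


section \<open>Graded free resolutions and regularity\<close>

text \<open>
  A rank function \<open>\<beta> :: nat \<Rightarrow> nat\<close> describes the graded free module
  \<open>\<Oplus>\<^sub>j R(-j)^(\<beta> j)\<close>: its basis elements are indexed by the pairs \<open>(j, l)\<close> with
  \<open>l < \<beta> j\<close>, the one with index \<open>(j, l)\<close> being of degree \<open>j\<close>. The elements of the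
  module are the finitely supported coordinate vectors.
\<close>

definition basis_index :: "(nat \<Rightarrow> nat) \<Rightarrow> (nat \<times> nat) set" where
  "basis_index \<beta> = {(j, l). l < \<beta> j}"

type_synonym ('v, 'k) free_elem = "(nat \<times> nat) \<Rightarrow>\<^sub>0 ('v, 'k) mpoly"

definition free_module :: "(nat \<Rightarrow> nat) \<Rightarrow> ('v, 'k::field) free_elem set" where
  "free_module \<beta> = {w. Poly_Mapping.keys w \<subseteq> basis_index \<beta>}"

definition free_scale :: "('v, 'k::field) mpoly \<Rightarrow> ('v, 'k) free_elem \<Rightarrow> ('v, 'k) free_elem" where
  "free_scale p w = Poly_Mapping.map (\<lambda>q. p * q) w"

text \<open>Being of degree \<open>j\<close> takes the shifts \<open>R(-c)\<close> of the summands into account.\<close>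

definition free_homogeneous :: "nat \<Rightarrow> ('v::finite, 'k::field) free_elem \<Rightarrow> bool" where
  "free_homogeneous j w \<longleftrightarrow>
     (\<forall>b. \<forall>t\<in>Poly_Mapping.keys (Poly_Mapping.lookup w b). fst b + mon_deg t = j)"

text \<open>
  The linear map out of a free module that sends the basis element with index \<open>b\<close> to
  \<open>\<phi> b\<close>, where \<open>scl\<close> is the scalar multiplication of the target.
\<close>

definition free_hom ::
  "('r \<Rightarrow> 'm \<Rightarrow> 'm) \<Rightarrow> ('b \<Rightarrow> 'm) \<Rightarrow> ('b \<Rightarrow>\<^sub>0 'r::zero) \<Rightarrow> 'm::comm_monoid_add" where
  "free_hom scl \<phi> w = (\<Sum>b\<in>Poly_Mapping.keys w. scl (Poly_Mapping.lookup w b) (\<phi> b))"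

text \<open>
  A graded free resolution
  \<open>\<dots> \<rightarrow> F\<^sub>2 \<rightarrow> F\<^sub>1 \<rightarrow> F\<^sub>0 \<rightarrow> R/I \<rightarrow> 0\<close> of \<open>R/I\<close> for a homogeneous ideal \<open>I\<close>, with
  \<open>F\<^sub>i = \<Oplus>\<^sub>j R(-j)^(\<beta> i j)\<close> and all maps homogeneous of degree zero. The differential
  \<open>F\<^sub>i \<rightarrow> F\<^sub>i\<^sub>-\<^sub>1\<close> is given by the images \<open>d i b\<close> of the basis elements (\<open>d 0\<close> is not used)
  and the augmentation \<open>F\<^sub>0 \<rightarrow> R/I\<close> by representatives \<open>\<epsilon> b\<close> in \<open>R\<close> of the images of the
  basis elements.
\<close>

definition graded_free_resolution ::
  "('v::finite, 'k::field) mpoly set \<Rightarrow> (nat \<Rightarrow> nat \<Rightarrow> nat) \<Rightarrow>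
   (nat \<times> nat \<Rightarrow> ('v, 'k) mpoly) \<Rightarrow> (nat \<Rightarrow> nat \<times> nat \<Rightarrow> ('v, 'k) free_elem) \<Rightarrow> bool" where
  "graded_free_resolution I \<beta> \<epsilon> d \<longleftrightarrow>
     (\<forall>b\<in>basis_index (\<beta> 0). homogeneous (fst b) (\<epsilon> b)) \<and>
     (\<forall>i. \<forall>b\<in>basis_index (\<beta> (Suc i)).
        d (Suc i) b \<in> free_module (\<beta> i) \<and> free_homogeneous (fst b) (d (Suc i) b)) \<and>
     (\<forall>p. \<exists>w\<in>free_module (\<beta> 0). p - free_hom (*) \<epsilon> w \<in> I) \<and>
     free_hom free_scale (d 1) ` free_module (\<beta> 1) =
       {w \<in> free_module (\<beta> 0). free_hom (*) \<epsilon> w \<in> I} \<and>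
     (\<forall>i\<ge>1. free_hom free_scale (d (Suc i)) ` free_module (\<beta> (Suc i)) =
       {w \<in> free_module (\<beta> i). free_hom free_scale (d i) w = 0})"

text \<open>Minimality: the entries of all differentials lie in \<open>(x\<^sub>1, \<dots>, x\<^sub>n)\<close>.\<close>

definition minimal_graded_free_resolution ::
  "('v::finite, 'k::field) mpoly set \<Rightarrow> (nat \<Rightarrow> nat \<Rightarrow> nat) \<Rightarrow>
   (nat \<times> nat \<Rightarrow> ('v, 'k) mpoly) \<Rightarrow> (nat \<Rightarrow> nat \<times> nat \<Rightarrow> ('v, 'k) free_elem) \<Rightarrow> bool" where
  "minimal_graded_free_resolution I \<beta> \<epsilon> d \<longleftrightarrow>
     graded_free_resolution I \<beta> \<epsilon> d \<and>
     (\<forall>i. \<forall>b\<in>basis_index (\<beta> (Suc i)). \<forall>c.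
        Poly_Mapping.lookup (d (Suc i) b) c \<in> ideal_gen (range var))"

text \<open>
  \<open>graded_betti I i j\<close> is the graded Betti number \<open>\<beta>\<^sub>i\<^sub>,\<^sub>j(R/I)\<close>. Every homogeneous ideal \<open>I\<close>
  has a minimal graded free resolution of \<open>R/I\<close>, and its ranks are determined by \<open>I\<close>. The
  modules \<open>F\<^sub>i\<close> are a priori allowed to have infinite rank (but finite rank in each degree)
  and the resolution is allowed to be infinite; minimality forces both to be finite.
\<close>

definition graded_betti :: "('v::finite, 'k::field) mpoly set \<Rightarrow> nat \<Rightarrow> nat \<Rightarrow> nat" where
  "graded_betti I = (SOME \<beta>. \<exists>\<epsilon> d. minimal_graded_free_resolution I \<beta> \<epsilon> d)"

text \<open>
  \<open>reg_quot I\<close> is \<open>reg (R/I)\<close>. The value is an extended real number because the zero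
  module (\<open>I = R\<close>) has regularity \<open>-\<infinity>\<close>.
\<close>

definition reg_quot :: "('v::finite, 'k::field) mpoly set \<Rightarrow> ereal" where
  "reg_quot I = Sup {ereal (real j - real i) | i j. graded_betti I i j \<noteq> 0}"


section \<open>Simplicial complexes and forests\<close>

definition simplicial_complex :: "'v set set \<Rightarrow> bool" where
  "simplicial_complex \<Delta> \<longleftrightarrow> (\<forall>v. {v} \<in> \<Delta>) \<and> (\<forall>G\<in>\<Delta>. \<forall>H. H \<subseteq> G \<longrightarrow> H \<in> \<Delta>)"

definition facets :: "'v set set \<Rightarrow> 'v set set" where
  "facets \<Delta> = {G \<in> \<Delta>. \<forall>H\<in>\<Delta>. G \<subseteq> H \<longrightarrow> G = H}"

text \<open>
  \<open>generated S\<close> is \<open>\<langle>S\<rangle>\<close>; its facets are the members of \<open>S\<close> whenever these are pairwise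
  incomparable, as is the case for sets of facets of a complex. It need not contain all
  singletons of \<open>'v\<close>.
\<close>

definition generated :: "'v set set \<Rightarrow> 'v set set" where
  "generated S = {H. \<exists>G\<in>S. H \<subseteq> G}"

definition leaf :: "'v set set \<Rightarrow> 'v set \<Rightarrow> bool" where
  "leaf \<Delta> F \<longleftrightarrow> F \<in> facets \<Delta> \<and>
     (facets \<Delta> = {F} \<or>
      (\<exists>G\<in>facets \<Delta>. G \<noteq> F \<and> (\<forall>H\<in>facets \<Delta>. H \<noteq> F \<longrightarrow> H \<inter> F \<subseteq> G \<inter> F)))"

definition simplicial_forest :: "'v set set \<Rightarrow> bool" where
  "simplicial_forest \<Delta> \<longleftrightarrow> simplicial_complex \<Delta> \<and>
     (\<forall>S. S \<subseteq> facets \<Delta> \<and> S \<noteq> {} \<longrightarrow> (\<exists>F. leaf (generated S) F))"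

definition good_leaf :: "'v set set \<Rightarrow> 'v set \<Rightarrow> bool" where
  "good_leaf \<Delta> F \<longleftrightarrow> F \<in> facets \<Delta> \<and>
     (\<forall>S. S \<subseteq> facets \<Delta> \<and> F \<in> S \<longrightarrow> leaf (generated S) F)"

definition good_leaf_ordering :: "'v set set \<Rightarrow> nat \<Rightarrow> (nat \<Rightarrow> 'v set) \<Rightarrow> bool" where
  "good_leaf_ordering \<Delta> r F \<longleftrightarrow>
     bij_betw F {1..r} (facets \<Delta>) \<and> (\<forall>i\<in>{2..r}. good_leaf (generated (F ` {1..i})) (F i))"

definition face_monomial :: "'v set \<Rightarrow> ('v, 'k::field) mpoly" where
  "face_monomial G = (\<Prod>v\<in>G. var v)"

definition facet_ideal :: "'v set set \<Rightarrow> ('v, 'k::field) mpoly set" where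
  "facet_ideal \<Delta> = ideal_gen (face_monomial ` facets \<Delta>)"

end

theory Submission
  imports Defs
begin

text \<open>
  Multiplication by a monomial \<open>m\<close> of degree \<open>e\<close> gives, for every monomial ideal \<open>K\<close>, a short
  exact sequence
  \<open>0 \<rightarrow> R/(K : m)(-e) \<rightarrow> R/K \<rightarrow> R/(K + (m)) \<rightarrow> 0\<close>, and hence
  \<open>reg (R/K) \<le> max {e + reg (R/(K : m)), reg (R/(K + (m)))}\<close>. The theorem results from using
  this inequality for \<open>m\<^sub>r, m\<^sub>r\<^sub>-\<^sub>1, \<dots>, m\<^sub>1\<close> in turn, on the ideals
  \<open>K\<^sub>i = I(\<Delta>\<^sub>i)^(s+1) + J\<^sub>i\<close> with \<open>K\<^sub>r = I(\<Delta>)^(s+1)\<close>. A product of \<open>s+1\<close> facet monomials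
  that involves \<open>m\<^sub>i\<close> is a multiple of it, so \<open>K\<^sub>i + (m\<^sub>i) = K\<^sub>i\<^sub>-\<^sub>1\<close>, and the sequence of ideals
  ends with \<open>K\<^sub>0 = I(\<Delta>)\<close>. Colon ideals of monomial ideals by a monomial are computed monomial
  by monomial, so \<open>K\<^sub>i : m\<^sub>i = (I(\<Delta>\<^sub>i)^(s+1) : m\<^sub>i) + (J\<^sub>i : m\<^sub>i)\<close>, and
  \<open>I(\<Delta>\<^sub>i)^(s+1) : m\<^sub>i = I(\<Delta>\<^sub>i)^s\<close> (\<open>facet_power_colon\<close>): if a product of \<open>s+1\<close> facet monomials
  divides \<open>u m\<^sub>i\<close>, then omitting the facet that meets \<open>F\<^sub>i\<close> in the largest set leaves a
  divisor of \<open>u\<close>. This uses that the traces of the facets on a good leaf form a chain.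

  Regularity is read off from the graded Betti numbers, that is, from some minimal graded free
  resolution, and the inequality for it (\<open>reg_quot_le_colon_sum\<close>) is proved by means of
  resolutions alone. Three facts are needed. A minimal resolution exists
  (\<open>minimal_graded_free_resolution_exists\<close>): graded submodules of free modules that are finite
  dimensional in each degree have minimal homogeneous generators, found degree by degree.
  Resolutions of the outer terms of the sequence combine into one of the middle term
  (\<open>horseshoe\<close>). Finally, every degree of a basis
  element in step \<open>i\<close> of a minimal resolution occurs in step \<open>i\<close> of any other graded free
  resolution (\<open>degrees_of_minimal_resolution\<close>); this is what remains of the uniqueness of minimal
  resolutions if one only asks which Betti numbers vanish.
\<close>

section \<open>Linear maps out of free modules\<close>

lemma ring_module: "module ((*) :: 'a::comm_ring_1 \<Rightarrow> 'a \<Rightarrow> 'a)"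
  by standard (simp_all add: algebra_simps)

text \<open>
  Scalar multiplication as in \<open>free_scale\<close>, for bases of any type: the resolution built by the
  horseshoe construction has as basis the disjoint union of two bases.
\<close>

definition fscale :: "'r::comm_ring_1 \<Rightarrow> ('b \<Rightarrow>\<^sub>0 'r) \<Rightarrow> ('b \<Rightarrow>\<^sub>0 'r)" where
  "fscale p w = Poly_Mapping.map (\<lambda>q. p * q) w"

lemma free_scale_eq_fscale: "free_scale = fscale"
  by (intro ext) (simp add: free_scale_def fscale_def)

lemma lookup_fscale [simp]: "Poly_Mapping.lookup (fscale p w) b = p * Poly_Mapping.lookup w b"
  unfolding fscale_def by (simp add: map.rep_eq when_def)

interpretation fmod: module "fscale :: 'r::comm_ring_1 \<Rightarrow> ('b \<Rightarrow>\<^sub>0 'r) \<Rightarrow> ('b \<Rightarrow>\<^sub>0 'r)"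
  by standard (rule poly_mapping_eqI; simp add: lookup_add distrib_left distrib_right mult.assoc)+

definition basis_vec :: "'b \<Rightarrow> ('b \<Rightarrow>\<^sub>0 'r::comm_ring_1)" where
  "basis_vec b = Poly_Mapping.single b 1"

definition free_on :: "'b set \<Rightarrow> ('b \<Rightarrow>\<^sub>0 'r::comm_ring_1) set" where
  "free_on B = {w. Poly_Mapping.keys w \<subseteq> B}"

lemma free_onD: "w \<in> free_on B \<Longrightarrow> b \<in> Poly_Mapping.keys w \<Longrightarrow> b \<in> B"
  by (auto simp: free_on_def)

lemma free_on_iff: "w \<in> free_on B \<longleftrightarrow> (\<forall>b. b \<notin> B \<longrightarrow> Poly_Mapping.lookup w b = 0)"
  by (auto simp: free_on_def in_keys_iff)

lemma free_on_lookup: "w \<in> free_on B \<Longrightarrow> b \<notin> B \<Longrightarrow> Poly_Mapping.lookup w b = 0"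
  by (auto simp: free_on_def in_keys_iff)

lemma subspace_free_on: "module.subspace fscale (free_on B)"
  by (rule fmod.subspaceI) (auto simp: free_on_iff lookup_add)

lemma basis_vec_in_free_on: "b \<in> B \<Longrightarrow> basis_vec b \<in> free_on B"
  by (auto simp: free_on_def basis_vec_def split: if_splits)

lemma lookup_basis_vec: "Poly_Mapping.lookup (basis_vec b) c = (if b = c then 1 else 0)"
  by (simp add: basis_vec_def lookup_single when_def)

lemma basis_vec_expansion:
  "w = (\<Sum>b\<in>Poly_Mapping.keys w. fscale (Poly_Mapping.lookup w b) (basis_vec b))"
proof (rule poly_mapping_eqI)
  fix k
  have "Poly_Mapping.lookup (\<Sum>b\<in>Poly_Mapping.keys w. fscale (Poly_Mapping.lookup w b) (basis_vec b)) k
      = (\<Sum>b\<in>Poly_Mapping.keys w. if b = k then Poly_Mapping.lookup w b else 0)"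
    unfolding lookup_sum by (rule sum.cong) (simp_all add: lookup_basis_vec)
  then show "Poly_Mapping.lookup w k =
      Poly_Mapping.lookup (\<Sum>b\<in>Poly_Mapping.keys w. fscale (Poly_Mapping.lookup w b) (basis_vec b)) k"
    by (simp add: in_keys_iff)
qed

context module
begin

lemma free_hom_superset:
  assumes "finite A" "Poly_Mapping.keys w \<subseteq> A"
  shows "free_hom scale \<phi> w = (\<Sum>b\<in>A. scale (Poly_Mapping.lookup w b) (\<phi> b))"
  unfolding free_hom_def using assms
  by (intro sum.mono_neutral_left) (auto simp: in_keys_iff)

lemma module_hom_free_hom: "module_hom fscale scale (free_hom scale \<phi>)"
proof
  fix v w :: "'c \<Rightarrow>\<^sub>0 'a" and r
  let ?A = "Poly_Mapping.keys v \<union> Poly_Mapping.keys w"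
  have A: "free_hom scale \<phi> v = (\<Sum>b\<in>?A. scale (Poly_Mapping.lookup v b) (\<phi> b))"
    "free_hom scale \<phi> w = (\<Sum>b\<in>?A. scale (Poly_Mapping.lookup w b) (\<phi> b))"
    "free_hom scale \<phi> (v + w) = (\<Sum>b\<in>?A. scale (Poly_Mapping.lookup (v + w) b) (\<phi> b))"
    by (rule free_hom_superset; use keys_add[of v w] in auto)+
  show "free_hom scale \<phi> (v + w) = free_hom scale \<phi> v + free_hom scale \<phi> w"
    unfolding A by (simp add: lookup_add scale_left_distrib sum.distrib)
  have "free_hom scale \<phi> (fscale r w) =
      (\<Sum>b\<in>Poly_Mapping.keys w. scale (Poly_Mapping.lookup (fscale r w) b) (\<phi> b))"
    by (rule free_hom_superset) (auto simp: in_keys_iff)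
  then show "free_hom scale \<phi> (fscale r w) = scale r (free_hom scale \<phi> w)"
    by (simp add: free_hom_def scale_sum_right)
qed

lemma free_hom_basis_vec [simp]: "free_hom scale \<phi> (basis_vec b) = \<phi> b"
proof (cases "(1::'a) = 0")
  case True
  then have "x = 0" for x :: 'b by (metis scale_one scale_zero_left)
  then show ?thesis by metis
next
  case False
  then show ?thesis by (simp add: free_hom_def basis_vec_def)
qed

text \<open>
  A linear map on a free module is determined by its values on the basis. Equality of two maps is
  the case \<open>N = 0\<close> for their difference.
\<close>

lemma hom_free_on_mem:
  assumes "module_hom fscale scale f" "w \<in> free_on B" "subspace N"
    and "\<And>b. b \<in> B \<Longrightarrow> f (basis_vec b) \<in> N"
  shows "f w \<in> N"
proof -
  interpret f: module_hom fscale scale f by fact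
  have "f w = (\<Sum>b\<in>Poly_Mapping.keys w. scale (Poly_Mapping.lookup w b) (f (basis_vec b)))"
    using arg_cong[OF basis_vec_expansion[of w], of f] by (simp add: f.sum f.scale)
  also have "\<dots> \<in> N"
    using assms by (intro subspace_sum subspace_scale) (auto dest: free_onD)
  finally show ?thesis .
qed

lemma hom_free_on_eq:
  assumes f: "module_hom fscale scale f" and g: "module_hom fscale scale g" and w: "w \<in> free_on B"
    and "\<And>b. b \<in> B \<Longrightarrow> f (basis_vec b) = g (basis_vec b)"
  shows "f w = g w"
proof -
  have "module_hom fscale scale (\<lambda>x. f x - g x)"
    by (rule module_pair.module_hom_sub[OF module_pair.intro[OF fmod.module_axioms module_axioms] f g])
  from hom_free_on_mem[OF this w subspace_single_0] assms(4) show ?thesis by simp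
qed

lemmas free_hom_mem = hom_free_on_mem[OF module_hom_free_hom, simplified]

lemma free_hom_add: "free_hom scale \<phi> (v + w) = free_hom scale \<phi> v + free_hom scale \<phi> w"
  by (rule module_hom.add[OF module_hom_free_hom])

lemma free_hom_diff: "free_hom scale \<phi> (v - w) = free_hom scale \<phi> v - free_hom scale \<phi> w"
  by (rule module_hom.diff[OF module_hom_free_hom])

lemma free_hom_scale: "free_hom scale \<phi> (fscale p w) = scale p (free_hom scale \<phi> w)"
  by (rule module_hom.scale[OF module_hom_free_hom])

lemma free_hom_zero [simp]: "free_hom scale \<phi> 0 = 0"
  by (simp add: free_hom_def)

lemma free_hom_fun_diff:
  "free_hom scale (\<lambda>b. \<phi> b - \<psi> b) w = free_hom scale \<phi> w - free_hom scale \<psi> w"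
  by (simp add: free_hom_def scale_right_diff_distrib sum_subtractf)

lemma free_hom_fun_add:
  "free_hom scale (\<lambda>b. \<phi> b + \<psi> b) w = free_hom scale \<phi> w + free_hom scale \<psi> w"
  by (simp add: free_hom_def scale_right_distrib sum.distrib)

lemma free_hom_comp:
  "free_hom scale \<phi> (free_hom fscale \<psi> w) = free_hom scale (\<lambda>b. free_hom scale \<phi> (\<psi> b)) w"
proof -
  have "module_hom fscale scale (free_hom scale \<phi> \<circ> free_hom fscale \<psi>)"
    by (rule module_hom_compose[OF fmod.module_hom_free_hom module_hom_free_hom])
  then have "(free_hom scale \<phi> \<circ> free_hom fscale \<psi>) w
      = free_hom scale (\<lambda>b. free_hom scale \<phi> (\<psi> b)) w"
    by (rule hom_free_on_eq[OF _ module_hom_free_hom, of _ w UNIV])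
      (simp_all add: free_on_def fmod.free_hom_basis_vec)
  then show ?thesis by simp
qed

lemma free_hom_cong:
  assumes "w \<in> free_on B" "\<And>b. b \<in> B \<Longrightarrow> \<phi> b = \<psi> b"
  shows "free_hom scale \<phi> w = free_hom scale \<psi> w"
  by (rule hom_free_on_eq[OF module_hom_free_hom module_hom_free_hom assms(1)]) (simp add: assms)

end

lemma free_hom_id: "free_hom fscale basis_vec w = w"
  unfolding free_hom_def by (rule basis_vec_expansion[symmetric])


section \<open>Gradings\<close>

lemma mon_deg_0 [simp]: "mon_deg 0 = 0"
  by (simp add: mon_deg_def)

lemma mon_deg_add: "mon_deg (s + t) = mon_deg s + mon_deg t"
  by (simp add: mon_deg_def lookup_add sum.distrib)

lemma mon_deg_eq_0_iff: "mon_deg t = 0 \<longleftrightarrow> t = 0"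
  by (auto simp: mon_deg_def poly_mapping_eq_iff fun_eq_iff)

definition hcomp :: "nat \<Rightarrow> ('v::finite, 'k::field) mpoly \<Rightarrow> ('v, 'k) mpoly" where
  "hcomp n p = Poly_Mapping.mapp (\<lambda>t c. if mon_deg t = n then c else 0) p"

lemma lookup_hcomp:
  "Poly_Mapping.lookup (hcomp n p) t = (if mon_deg t = n then Poly_Mapping.lookup p t else 0)"
  by (simp add: hcomp_def lookup_mapp when_def in_keys_iff)

lemma homogeneous_iff: "homogeneous n p \<longleftrightarrow> hcomp n p = p"
  by (auto simp: homogeneous_def poly_mapping_eq_iff fun_eq_iff lookup_hcomp in_keys_iff)

text \<open>The part of degree \<open>n\<close> of a free module whose basis element \<open>b\<close> has degree \<open>dg b\<close>.\<close>

definition fcomp :: "('b \<Rightarrow> nat) \<Rightarrow> nat \<Rightarrow> ('b \<Rightarrow>\<^sub>0 ('v::finite, 'k::field) mpoly) \<Rightarrow>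
    ('b \<Rightarrow>\<^sub>0 ('v, 'k) mpoly)" where
  "fcomp dg n w = Poly_Mapping.mapp (\<lambda>b p. if dg b \<le> n then hcomp (n - dg b) p else 0) w"

lemma hcomp_0 [simp]: "hcomp n 0 = 0"
  by (simp add: poly_mapping_eq_iff fun_eq_iff lookup_hcomp)

lemma lookup_fcomp:
  "Poly_Mapping.lookup (fcomp dg n w) b =
    (if dg b \<le> n then hcomp (n - dg b) (Poly_Mapping.lookup w b) else 0)"
  by (auto simp: fcomp_def lookup_mapp when_def in_keys_iff)

lemma lookup_lookup_fcomp:
  "Poly_Mapping.lookup (Poly_Mapping.lookup (fcomp dg n w) b) t =
    (if dg b + mon_deg t = n then Poly_Mapping.lookup (Poly_Mapping.lookup w b) t else 0)"
  by (auto simp: lookup_fcomp lookup_hcomp)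

lemma double_poly_mapping_eqI:
  assumes "\<And>b t. Poly_Mapping.lookup (Poly_Mapping.lookup v b) t
    = Poly_Mapping.lookup (Poly_Mapping.lookup w b) t"
  shows "v = w"
  using assms by (simp add: poly_mapping_eqI)

lemma free_homogeneous_iff: "free_homogeneous n w \<longleftrightarrow> fcomp fst n w = w"
  unfolding free_homogeneous_def poly_mapping_eq_iff[of "fcomp fst n w"] fun_eq_iff
    poly_mapping_eq_iff[of "Poly_Mapping.lookup (fcomp fst n w) _"] lookup_lookup_fcomp Ball_def in_keys_iff
  by (intro iff_allI) auto

lemma homogeneous_mult:
  assumes "homogeneous i p" "homogeneous j q"
  shows "homogeneous (i + j) (p * q)"
  using assms keys_mult[of p q] unfolding homogeneous_def by (force simp: mon_deg_add)

lemma hcomp_add: "hcomp n (p + q) = hcomp n p + hcomp n q"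
  by (auto simp: poly_mapping_eq_iff fun_eq_iff lookup_hcomp lookup_add)

lemma hcomp_hcomp: "hcomp n (hcomp k p) = (if n = k then hcomp n p else 0)"
  by (auto simp: poly_mapping_eq_iff fun_eq_iff lookup_hcomp)

lemma hcomp_single_0: "hcomp n (Poly_Mapping.single 0 c) = (if n = 0 then Poly_Mapping.single 0 c else 0)"
  by (rule poly_mapping_eqI) (auto simp: lookup_hcomp lookup_single when_def)

lemma hcomp_zero_degree: "hcomp 0 p = Poly_Mapping.single 0 (Poly_Mapping.lookup p 0)"
  by (rule poly_mapping_eqI) (auto simp: lookup_hcomp lookup_single when_def mon_deg_eq_0_iff)

lemma hcomp_sum_bound:
  assumes "\<And>t. t \<in> Poly_Mapping.keys p \<Longrightarrow> mon_deg t < N"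
  shows "p = (\<Sum>n<N. hcomp n p)"
proof (rule poly_mapping_eqI)
  fix t
  show "Poly_Mapping.lookup p t = Poly_Mapping.lookup (\<Sum>n<N. hcomp n p) t"
    using assms[of t] by (auto simp: lookup_sum lookup_hcomp in_keys_iff)
qed

lemma hcomp_sum_finite: "\<exists>N. p = (\<Sum>n<N. hcomp n p)"
proof -
  have "t \<in> Poly_Mapping.keys p \<Longrightarrow> mon_deg t < Suc (\<Sum>t\<in>Poly_Mapping.keys p. mon_deg t)" for t
    by (simp add: less_Suc_eq_le member_le_sum)
  from hcomp_sum_bound[OF this] show ?thesis by blast
qed

text \<open>
  Products of homogeneous polynomials are homogeneous, so only the component of \<open>p\<close> of
  complementary degree contributes.
\<close>

lemma hcomp_homogeneous_mult:
  assumes "hcomp j q = q"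
  shows "hcomp n (p * q) = (if j \<le> n then hcomp (n - j) p * q else 0)"
proof -
  obtain N where N: "p = (\<Sum>i<N. hcomp i p)" using hcomp_sum_finite by blast
  have *: "hcomp n (hcomp i p * q) = (if i + j = n then hcomp i p * q else 0)" for i
  proof -
    have "homogeneous (i + j) (hcomp i p * q)"
      using assms by (intro homogeneous_mult) (auto simp: homogeneous_iff hcomp_hcomp)
    then show ?thesis unfolding homogeneous_iff by (metis hcomp_hcomp)
  qed
  have sum: "hcomp m (sum f A) = (\<Sum>a\<in>A. hcomp m (f a))" for m f and A :: "nat set"
    by (induction A rule: infinite_finite_induct) (auto simp: hcomp_add)
  have "hcomp n (p * q) = (\<Sum>i<N. if i + j = n then hcomp i p * q else 0)"
    using arg_cong[OF N, of "\<lambda>x. hcomp n (x * q)"] by (simp add: sum_distrib_right sum *)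
  also have "\<dots> = (if j \<le> n then (\<Sum>i<N. if i = n - j then hcomp i p * q else 0) else 0)"
    by (auto intro!: sum.cong sum.neutral simp del: sum.delta sum.delta')
  also have "(\<Sum>i<N. if i = n - j then hcomp i p * q else 0) = hcomp (n - j) p * q"
  proof (cases "n - j < N")
    case False
    have "hcomp (n - j) p = (\<Sum>i<N. hcomp (n - j) (hcomp i p))"
      using arg_cong[OF N, of "hcomp (n - j)"] unfolding sum .
    also have "\<dots> = 0" using False by (auto simp: hcomp_hcomp)
    finally show ?thesis using False by simp
  qed simp
  finally show ?thesis by simp
qed

text \<open>
  Graded modules over the polynomial ring, given by the projections \<open>hc n\<close> to the homogeneous
  parts. Both \<open>R\<close>, the target of augmentations, and the free modules, the targets of
  differentials, are instances. Scalar multiplication is described for homogeneous \<open>x\<close> only,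
  where the component of the product is again a product; other elements are sums of such \<open>x\<close>.
\<close>

locale graded_module = module scl
  for scl :: "('v::finite, 'k::field) mpoly \<Rightarrow> 'm::ab_group_add \<Rightarrow> 'm" +
  fixes hc :: "nat \<Rightarrow> 'm \<Rightarrow> 'm"
  assumes hc_add: "hc n (x + y) = hc n x + hc n y"
    and hc_hc: "hc n (hc k x) = (if n = k then hc n x else 0)"
    and hc_scl: "hc j x = x \<Longrightarrow> hc n (scl p x) = (if j \<le> n then scl (hcomp (n - j) p) x else 0)"
    and hc_sum_finite: "\<exists>N. x = (\<Sum>n<N. hc n x)"
begin

lemma hc_0 [simp]: "hc n 0 = 0"
  using hc_add[of n 0 0] by simp

lemma hc_diff: "hc n (x - y) = hc n x - hc n y"
  using hc_add[of n "x - y" y] by simp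

lemma hc_minus: "hc n (- x) = - hc n x"
  using hc_diff[of n 0 x] by simp

lemma hc_sum: "hc n (sum f A) = (\<Sum>a\<in>A. hc n (f a))"
  by (induction A rule: infinite_finite_induct) (auto simp: hc_add)

text \<open>
  A map that sends each basis element to an element of the same degree is homogeneous of degree
  zero, so it commutes with the projections. This is what allows homogeneous choices of preimages
  below.
\<close>

lemma hc_free_hom:
  assumes "\<And>b. b \<in> B \<Longrightarrow> hc (dg b) (\<phi> b) = \<phi> b" and "w \<in> free_on B"
  shows "hc n (free_hom scl \<phi> w) = free_hom scl \<phi> (fcomp dg n w)"
proof -
  have "hc n (free_hom scl \<phi> w) =
      (\<Sum>b\<in>Poly_Mapping.keys w. scl (Poly_Mapping.lookup (fcomp dg n w) b) (\<phi> b))"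
    unfolding free_hom_def hc_sum
  proof (rule sum.cong[OF refl])
    fix b assume "b \<in> Poly_Mapping.keys w"
    then have "hc (dg b) (\<phi> b) = \<phi> b" using assms by (auto dest: free_onD)
    then show "hc n (scl (Poly_Mapping.lookup w b) (\<phi> b))
        = scl (Poly_Mapping.lookup (fcomp dg n w) b) (\<phi> b)"
      by (simp add: hc_scl lookup_fcomp)
  qed
  also have "\<dots> = free_hom scl \<phi> (fcomp dg n w)"
    by (rule free_hom_superset[symmetric]) (auto simp: in_keys_iff lookup_fcomp split: if_splits)
  finally show ?thesis .
qed

end

lemma poly_graded: "graded_module ((*) :: ('v::finite, 'k::field) mpoly \<Rightarrow> _) hcomp"
  by (intro graded_module.intro graded_module_axioms.intro ring_module) (rule hcomp_add hcomp_hcomp hcomp_homogeneous_mult hcomp_sum_finite, assumption?)+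

lemma graded_module_free:
  "graded_module fscale (fcomp (dg :: 'b \<Rightarrow> nat) ::
     nat \<Rightarrow> ('b \<Rightarrow>\<^sub>0 ('v::finite, 'k::field) mpoly) \<Rightarrow> _)"
proof
  fix n k and x y :: "'b \<Rightarrow>\<^sub>0 ('v, 'k) mpoly" and j p
  show "fcomp dg n (x + y) = fcomp dg n x + fcomp dg n y"
    by (rule double_poly_mapping_eqI) (simp add: lookup_lookup_fcomp lookup_add)
  show "fcomp dg n (fcomp dg k x) = (if n = k then fcomp dg n x else 0)"
    by (rule double_poly_mapping_eqI) (simp add: lookup_lookup_fcomp)
  show "fcomp dg n (fscale p x) = (if j \<le> n then fscale (hcomp (n - j) p) x else 0)"
    if "fcomp dg j x = x"
  proof (rule poly_mapping_eqI)
    fix b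
    show "Poly_Mapping.lookup (fcomp dg n (fscale p x)) b =
        Poly_Mapping.lookup (if j \<le> n then fscale (hcomp (n - j) p) x else 0) b"
    proof (cases "dg b \<le> j")
      case True
      then have "hcomp (j - dg b) (Poly_Mapping.lookup x b) = Poly_Mapping.lookup x b"
        using lookup_fcomp[of dg j x b] that by simp
      from hcomp_homogeneous_mult[OF this, of "n - dg b" p] True show ?thesis
        by (auto simp: lookup_fcomp)
    next
      case False
      then have "Poly_Mapping.lookup x b = 0"
        using lookup_fcomp[of dg j x b] that by simp
      then show ?thesis by (simp add: lookup_fcomp)
    qed
  qed
  define N where
    "N = Suc (\<Sum>b\<in>Poly_Mapping.keys x. \<Sum>t\<in>Poly_Mapping.keys (Poly_Mapping.lookup x b). dg b + mon_deg t)"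
  have bound: "dg b + mon_deg t < N" if "Poly_Mapping.lookup (Poly_Mapping.lookup x b) t \<noteq> 0" for b t
  proof -
    have b: "b \<in> Poly_Mapping.keys x" and t: "t \<in> Poly_Mapping.keys (Poly_Mapping.lookup x b)"
      using that by (auto simp: in_keys_iff)
    have "dg b + mon_deg t \<le> (\<Sum>t\<in>Poly_Mapping.keys (Poly_Mapping.lookup x b). dg b + mon_deg t)"
      using t by (intro member_le_sum) auto
    also have "\<dots> \<le> (\<Sum>b\<in>Poly_Mapping.keys x. \<Sum>t\<in>Poly_Mapping.keys (Poly_Mapping.lookup x b). dg b + mon_deg t)"
      using b by (intro member_le_sum[where f = "\<lambda>b. \<Sum>t\<in>Poly_Mapping.keys (Poly_Mapping.lookup x b). dg b + mon_deg t"]) auto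
    finally show ?thesis by (simp add: N_def)
  qed
  have "x = (\<Sum>n<N. fcomp dg n x)"
  proof (rule double_poly_mapping_eqI)
    fix b t
    show "Poly_Mapping.lookup (Poly_Mapping.lookup x b) t =
        Poly_Mapping.lookup (Poly_Mapping.lookup (\<Sum>n<N. fcomp dg n x) b) t"
      using bound[of b t] by (auto simp: lookup_sum lookup_lookup_fcomp)
  qed
  then show "\<exists>N. x = (\<Sum>n<N. fcomp dg n x)" by blast
qed

interpretation free_graded: graded_module
    "fscale :: ('v::finite, 'k::field) mpoly \<Rightarrow> ('b \<Rightarrow>\<^sub>0 ('v, 'k) mpoly) \<Rightarrow> _" "fcomp dg"
  for dg by (rule graded_module_free)

lemma fcomp_free_on: "w \<in> free_on B \<Longrightarrow> fcomp dg n w \<in> free_on B"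
  by (auto simp: free_on_iff lookup_fcomp)


section \<open>Monomial ideals\<close>

text \<open>
  The exponents of the monomials that are divisible by one of those with exponents in \<open>S\<close>. All
  ideals of the theorem are spanned by monomials, and computing with them reduces to computing
  with such sets of exponents.
\<close>

definition up_closure :: "('v \<Rightarrow>\<^sub>0 nat) set \<Rightarrow> ('v \<Rightarrow>\<^sub>0 nat) set" where
  "up_closure S = {s + u | s u. s \<in> S}"

definition mono_ideal :: "('v \<Rightarrow>\<^sub>0 nat) set \<Rightarrow> ('v, 'k::field) mpoly set" where
  "mono_ideal U = {p. Poly_Mapping.keys p \<subseteq> U}"

lemma up_closure_add: "t \<in> up_closure S \<Longrightarrow> t + u \<in> up_closure S"
  unfolding up_closure_def mem_Collect_eq by (metis add.assoc)

lemma subset_up_closure: "S \<subseteq> up_closure S"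
  unfolding up_closure_def by (force intro: exI[of _ 0])

lemma sum_single: "p = (\<Sum>t\<in>Poly_Mapping.keys p. Poly_Mapping.single t (Poly_Mapping.lookup p t))"
  by (rule poly_mapping_eqI) (simp add: lookup_sum lookup_single when_def in_keys_iff)

lemma subspace_mono_ideal:
  assumes "\<And>t u. t \<in> U \<Longrightarrow> t + u \<in> U"
  shows "module.subspace (*) (mono_ideal U :: ('v, 'k::field) mpoly set)"
proof (rule module.subspaceI[OF ring_module])
  show "p + q \<in> mono_ideal U" if "p \<in> mono_ideal U" "q \<in> mono_ideal U" for p q :: "('v, 'k) mpoly"
    using that keys_add[of p q] by (auto simp: mono_ideal_def)
  show "c * p \<in> mono_ideal U" if "p \<in> mono_ideal U" for p c :: "('v, 'k) mpoly"
  proof -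
    have "b + a \<in> U" if "a \<in> Poly_Mapping.keys p" for a b
      using assms[of a b] that \<open>p \<in> mono_ideal U\<close> by (auto simp: mono_ideal_def add.commute)
    then show ?thesis
      using keys_mult[of c p] by (auto simp: mono_ideal_def)
  qed
qed (simp add: mono_ideal_def)

lemma ideal_gen_monomials:
  "ideal_gen ((\<lambda>s. Poly_Mapping.single s (1::'k::field)) ` S) = mono_ideal (up_closure S)"
proof
  show "ideal_gen ((\<lambda>s. Poly_Mapping.single s (1::'k)) ` S) \<subseteq> mono_ideal (up_closure S)"
    unfolding ideal_gen_def using subset_up_closure[of S]
    by (intro module.span_minimal[OF ring_module] subspace_mono_ideal up_closure_add)
      (auto simp: mono_ideal_def)
next
  show "mono_ideal (up_closure S) \<subseteq> ideal_gen ((\<lambda>s. Poly_Mapping.single s (1::'k)) ` S)"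
  proof
    fix p :: "('a, 'k) mpoly"
    assume p: "p \<in> mono_ideal (up_closure S)"
    show "p \<in> ideal_gen ((\<lambda>s. Poly_Mapping.single s (1::'k)) ` S)"
      unfolding ideal_gen_def
    proof (subst sum_single, rule module.span_sum[OF ring_module])
      fix t assume "t \<in> Poly_Mapping.keys p"
      then obtain s u where t: "t = u + s" "s \<in> S"
        using p by (auto simp: mono_ideal_def up_closure_def add.commute)
      have "Poly_Mapping.single t (Poly_Mapping.lookup p t)
          = Poly_Mapping.single u (Poly_Mapping.lookup p t) * Poly_Mapping.single s 1"
        by (simp add: mult_single t)
      also have "\<dots> \<in> module.span (*) ((\<lambda>s. Poly_Mapping.single s (1::'k)) ` S)"
        using t by (intro module.span_scale[OF ring_module] module.span_base[OF ring_module]) auto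
      finally show "Poly_Mapping.single t (Poly_Mapping.lookup p t) \<in>
          module.span (*) ((\<lambda>s. Poly_Mapping.single s (1::'k)) ` S)" .
    qed
  qed
qed

lemma up_closure_variables: "up_closure (range (\<lambda>v. Poly_Mapping.single v (1::nat))) = - {0}"
proof -
  have "t \<in> up_closure (range (\<lambda>v. Poly_Mapping.single v (1::nat)))" if "t \<noteq> 0" for t :: "'a \<Rightarrow>\<^sub>0 nat"
  proof -
    obtain v where v: "Poly_Mapping.lookup t v \<noteq> 0"
      using \<open>t \<noteq> 0\<close> by (metis poly_mapping_eqI lookup_zero)
    have "t = Poly_Mapping.single v 1 + (t - Poly_Mapping.single v 1)"
      using v by (intro poly_mapping_eqI) (auto simp: lookup_add lookup_minus lookup_single when_def)
    then show ?thesis unfolding up_closure_def by blast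
  qed
  moreover have "Poly_Mapping.single v (1::nat) + u \<noteq> 0" for v :: 'a and u
  proof
    assume "Poly_Mapping.single v (1::nat) + u = 0"
    from arg_cong[OF this, of "\<lambda>t. Poly_Mapping.lookup t v"] show False by (simp add: lookup_add)
  qed
  then have "0 \<notin> up_closure (range (\<lambda>v :: 'a. Poly_Mapping.single v (1::nat)))"
    by (auto simp: up_closure_def dest: sym)
  ultimately show ?thesis by auto
qed

text \<open>
  Because of this, minimality of a resolution says that the entries of the differentials have no
  constant term.
\<close>

lemma ideal_gen_variables: "p \<in> ideal_gen (range var) \<longleftrightarrow> Poly_Mapping.lookup p 0 = 0"
proof -
  have "range (var :: 'a \<Rightarrow> ('a, 'b) mpoly)
      = (\<lambda>s. Poly_Mapping.single s 1) ` range (\<lambda>v. Poly_Mapping.single v 1)"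
    unfolding image_image by (simp add: var_def fun_eq_iff)
  then have "ideal_gen (range var) = (mono_ideal (- {0}) :: ('a, 'b) mpoly set)"
    by (simp only: ideal_gen_monomials up_closure_variables)
  then show ?thesis by (auto simp: mono_ideal_def in_keys_iff)
qed

text \<open>The free submodule \<open>\<mm>F\<close>, where \<open>\<mm>\<close> is the ideal generated by the variables.\<close>

definition max_free :: "('b \<Rightarrow>\<^sub>0 ('v, 'k::field) mpoly) set" where
  "max_free = {w. \<forall>b. Poly_Mapping.lookup (Poly_Mapping.lookup w b) 0 = 0}"

lemma max_free_iff: "w \<in> max_free \<longleftrightarrow> (\<forall>b. Poly_Mapping.lookup w b \<in> ideal_gen (range var))"
  by (simp add: max_free_def ideal_gen_variables)

lemma subspace_variables: "module.subspace (*) (ideal_gen (range var) :: ('v, 'k::field) mpoly set)"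
  unfolding ideal_gen_def by (rule module.subspace_span[OF ring_module])

lemma subspace_max_free: "module.subspace fscale (max_free :: ('b \<Rightarrow>\<^sub>0 ('v, 'k::field) mpoly) set)"
  by (intro fmod.subspaceI)
    (auto simp: max_free_iff lookup_add intro: module.subspace_0[OF ring_module subspace_variables]
      module.subspace_add[OF ring_module subspace_variables]
      module.subspace_scale[OF ring_module subspace_variables])

text \<open>
  A linear map multiplies entries with polynomials, and \<open>\<mm>\<close> is an ideal.
\<close>

lemma hom_max_free:
  fixes f :: "('b \<Rightarrow>\<^sub>0 ('v, 'k::field) mpoly) \<Rightarrow> ('c \<Rightarrow>\<^sub>0 ('v, 'k) mpoly)"
  assumes "module_hom fscale fscale f" "w \<in> max_free"
  shows "f w \<in> max_free"
proof -
  interpret f: module_hom fscale fscale f by fact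
  have "f w = (\<Sum>b\<in>Poly_Mapping.keys w. fscale (Poly_Mapping.lookup w b) (f (basis_vec b)))"
    using arg_cong[OF basis_vec_expansion[of w], of f] by (simp add: f.sum f.scale)
  also have "\<dots> \<in> max_free"
  proof (rule fmod.subspace_sum[OF subspace_max_free])
    fix b
    have "Poly_Mapping.lookup w b * q \<in> ideal_gen (range var)" for q
      using assms(2) module.subspace_scale[OF ring_module subspace_variables, of "Poly_Mapping.lookup w b" q]
      by (simp add: max_free_iff mult.commute)
    then show "fscale (Poly_Mapping.lookup w b) (f (basis_vec b)) \<in> max_free"
      by (simp add: max_free_iff)
  qed
  finally show ?thesis .
qed


section \<open>Comparison of graded free resolutions\<close>

text \<open>
  Equivalently, the ideal is generated by homogeneous elements. The constructions below use the
  condition in this form, to replace elements of the ideal by their components.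
\<close>

definition homogeneous_ideal :: "('v::finite, 'k::field) mpoly set \<Rightarrow> bool" where
  "homogeneous_ideal I \<longleftrightarrow> module.subspace (*) I \<and> (\<forall>p\<in>I. \<forall>n. hcomp n p \<in> I)"

text \<open>
  Graded free resolutions of \<open>R/I\<close> in the sense of \<open>graded_free_resolution\<close>, but with basis
  sets \<open>B i\<close> of an arbitrary type and with a function \<open>dg\<close> that gives the degrees of the basis
  elements.
\<close>

locale graded_resolution =
  fixes I :: "('v::finite, 'k::field) mpoly set"
    and B :: "nat \<Rightarrow> 'b set" and dg :: "'b \<Rightarrow> nat"
    and \<epsilon> :: "'b \<Rightarrow> ('v, 'k) mpoly" and d :: "nat \<Rightarrow> 'b \<Rightarrow> ('b \<Rightarrow>\<^sub>0 ('v, 'k) mpoly)"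
  assumes hom_ideal: "homogeneous_ideal I"
    and aug_homogeneous: "b \<in> B 0 \<Longrightarrow> hcomp (dg b) (\<epsilon> b) = \<epsilon> b"
    and diff_mem: "b \<in> B (Suc i) \<Longrightarrow> d (Suc i) b \<in> free_on (B i)"
    and diff_homogeneous: "b \<in> B (Suc i) \<Longrightarrow> fcomp dg (dg b) (d (Suc i) b) = d (Suc i) b"
    and aug_surj: "\<exists>w\<in>free_on (B 0). p - free_hom (*) \<epsilon> w \<in> I"
    and exact_0: "free_hom fscale (d (Suc 0)) ` free_on (B (Suc 0)) =
      {w \<in> free_on (B 0). free_hom (*) \<epsilon> w \<in> I}"
    and exact_Suc: "free_hom fscale (d (Suc (Suc i))) ` free_on (B (Suc (Suc i))) =
      {w \<in> free_on (B (Suc i)). free_hom fscale (d (Suc i)) w = 0}"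
begin

text \<open>
  Exactness identifies these images with the kernels. Naming them allows the augmentation and the
  differentials to be treated alike in recursive constructions of chain maps.
\<close>

definition cycles :: "nat \<Rightarrow> ('b \<Rightarrow>\<^sub>0 ('v, 'k) mpoly) set" where
  "cycles i = free_hom fscale (d (Suc i)) ` free_on (B (Suc i))"

lemma cycles_0: "w \<in> cycles 0 \<longleftrightarrow> w \<in> free_on (B 0) \<and> free_hom (*) \<epsilon> w \<in> I"
  by (simp add: cycles_def exact_0)

lemma cycles_Suc: "w \<in> cycles (Suc i) \<longleftrightarrow> w \<in> free_on (B (Suc i)) \<and> free_hom fscale (d (Suc i)) w = 0"
  by (simp add: cycles_def exact_Suc)

lemma ideal: "module.subspace (*) I"
  using hom_ideal by (simp add: homogeneous_ideal_def)

lemma hcomp_ideal: "p \<in> I \<Longrightarrow> hcomp n p \<in> I"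
  using hom_ideal by (simp add: homogeneous_ideal_def)

lemma diff_cycles: "b \<in> B (Suc i) \<Longrightarrow> d (Suc i) b \<in> cycles i"
  unfolding cycles_def by (rule image_eqI[of _ _ "basis_vec b"]) (auto intro: basis_vec_in_free_on)

lemma subspace_cycles: "module.subspace fscale (cycles i)"
  unfolding cycles_def
  by (intro module_hom.subspace_image[OF fmod.module_hom_free_hom] subspace_free_on)

end

text \<open>
  The component of degree \<open>j\<close> of any preimage is a preimage, too.
\<close>

lemma (in graded_module) homogeneous_preimage:
  assumes "\<And>b. b \<in> B \<Longrightarrow> hc (dg b) (\<phi> b) = \<phi> b" and "hc j y = y"
    and "y \<in> free_hom scl \<phi> ` free_on B"
  obtains w where "w \<in> free_on B" "fcomp dg j w = w" "free_hom scl \<phi> w = y"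
proof -
  obtain w where w: "w \<in> free_on B" "y = free_hom scl \<phi> w" using assms(3) by blast
  show ?thesis
  proof
    show "fcomp dg j w \<in> free_on B" using w(1) by (rule fcomp_free_on)
    show "fcomp dg j (fcomp dg j w) = fcomp dg j w" by (simp add: free_graded.hc_hc)
    show "free_hom scl \<phi> (fcomp dg j w) = y"
      using hc_free_hom[of B dg \<phi> w j] assms(1,2) w by simp
  qed
qed

lemma free_hom_homogeneous:
  assumes "\<And>b. b \<in> B \<Longrightarrow> fcomp dg' (dg b) (g b) = g b" "w \<in> free_on B" "fcomp dg n w = w"
  shows "fcomp dg' n (free_hom fscale g w) = free_hom fscale g w"
  using free_graded.hc_free_hom[of B dg' dg g w n] assms by simp

text \<open>
  Homogeneous chain maps that induce the identity of \<open>R/I\<close>, given by their values on the bases.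
\<close>

definition comparison_map ::
  "('v::finite, 'k::field) mpoly set \<Rightarrow> (nat \<Rightarrow> 'b set) \<Rightarrow> ('b \<Rightarrow> nat) \<Rightarrow> ('b \<Rightarrow> ('v, 'k) mpoly) \<Rightarrow>
    (nat \<Rightarrow> 'b \<Rightarrow> ('b \<Rightarrow>\<^sub>0 ('v, 'k) mpoly)) \<Rightarrow> (nat \<Rightarrow> 'c set) \<Rightarrow> ('c \<Rightarrow> nat) \<Rightarrow> ('c \<Rightarrow> ('v, 'k) mpoly) \<Rightarrow>
    (nat \<Rightarrow> 'c \<Rightarrow> ('c \<Rightarrow>\<^sub>0 ('v, 'k) mpoly)) \<Rightarrow> (nat \<Rightarrow> 'b \<Rightarrow> ('c \<Rightarrow>\<^sub>0 ('v, 'k) mpoly)) \<Rightarrow> bool" where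
  "comparison_map I B dg \<epsilon> d B' dg' \<epsilon>' d' g \<longleftrightarrow>
    (\<forall>i. \<forall>b\<in>B i. g i b \<in> free_on (B' i) \<and> fcomp dg' (dg b) (g i b) = g i b) \<and>
    (\<forall>b\<in>B 0. free_hom (*) \<epsilon>' (g 0 b) - \<epsilon> b \<in> I) \<and>
    (\<forall>i. \<forall>b\<in>B (Suc i).
      free_hom fscale (d' (Suc i)) (g (Suc i) b) = free_hom fscale (g i) (d (Suc i) b))"

text \<open>
  Basis elements are lifted step by step: by the chain map property in the previous step, what has
  to be lifted is a cycle of the target resolution and therefore a boundary.
\<close>

lemma comparison_map_exists:
  fixes B :: "nat \<Rightarrow> 'b set" and B' :: "nat \<Rightarrow> 'c set" and I :: "('v::finite, 'k::field) mpoly set"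
  assumes F: "graded_resolution I B dg \<epsilon> d" and G: "graded_resolution I B' dg' \<epsilon>' d'"
  shows "\<exists>g. comparison_map I B dg \<epsilon> d B' dg' \<epsilon>' d' g"
proof -
  interpret F: graded_resolution I B dg \<epsilon> d by fact
  interpret G: graded_resolution I B' dg' \<epsilon>' d' by fact
  define P where "P i g \<longleftrightarrow>
      (\<forall>b\<in>B i. g b \<in> free_on (B' i) \<and> fcomp dg' (dg b) (g b) = g b) \<and>
      (\<forall>w\<in>F.cycles i. free_hom fscale g w \<in> G.cycles i) \<and>
      (i = 0 \<longrightarrow> (\<forall>b\<in>B 0. free_hom (*) \<epsilon>' (g b) - \<epsilon> b \<in> I))"
    for i and g :: "'b \<Rightarrow> ('c \<Rightarrow>\<^sub>0 ('v, 'k) mpoly)"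
  define Q where "Q i g g' \<longleftrightarrow>
      (\<forall>b\<in>B (Suc i). free_hom fscale (d' (Suc i)) (g' b) = free_hom fscale g (d (Suc i) b))"
    for i and g g' :: "'b \<Rightarrow> ('c \<Rightarrow>\<^sub>0 ('v, 'k) mpoly)"
  have "\<exists>g. \<forall>i. P i (g i) \<and> Q i (g i) (g (Suc i))"
  proof (rule dependent_nat_choice)
    have "\<exists>w. w \<in> free_on (B' 0) \<and> fcomp dg' (dg b) w = w \<and> free_hom (*) \<epsilon>' w - \<epsilon> b \<in> I"
      if b: "b \<in> B 0" for b
    proof -
      obtain w where w: "w \<in> free_on (B' 0)" "\<epsilon> b - free_hom (*) \<epsilon>' w \<in> I"
        using G.aug_surj by blast
      have "hcomp (dg b) (\<epsilon> b - free_hom (*) \<epsilon>' w) = \<epsilon> b - free_hom (*) \<epsilon>' (fcomp dg' (dg b) w)"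
        using graded_module.hc_free_hom[OF poly_graded G.aug_homogeneous w(1), where n = "dg b"]
        by (simp add: graded_module.hc_diff[OF poly_graded] F.aug_homogeneous[OF b])
      then have "- (\<epsilon> b - free_hom (*) \<epsilon>' (fcomp dg' (dg b) w)) \<in> I"
        using module.subspace_neg[OF ring_module F.ideal F.hcomp_ideal[OF w(2), of "dg b"]] by simp
      then show ?thesis
        using w(1) by (intro exI[of _ "fcomp dg' (dg b) w"]) (simp add: fcomp_free_on free_graded.hc_hc)
    qed
    then obtain g where g: "\<And>b. b \<in> B 0 \<Longrightarrow> g b \<in> free_on (B' 0) \<and> fcomp dg' (dg b) (g b) = g b \<and>
        free_hom (*) \<epsilon>' (g b) - \<epsilon> b \<in> I" by metis
    have "free_hom fscale g w \<in> G.cycles 0" if w: "w \<in> F.cycles 0" for w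
    proof -
      have w0: "w \<in> free_on (B 0)" and wI: "free_hom (*) \<epsilon> w \<in> I" using w by (auto simp: F.cycles_0)
      have mem: "free_hom fscale g w \<in> free_on (B' 0)"
        by (rule fmod.free_hom_mem[OF w0 subspace_free_on]) (use g in blast)
      have "free_hom (*) (\<lambda>b. free_hom (*) \<epsilon>' (g b)) w - free_hom (*) \<epsilon> w \<in> I"
        by (rule module.hom_free_on_mem[OF ring_module _ w0 F.ideal, where
              f = "\<lambda>w. free_hom (*) (\<lambda>b. free_hom (*) \<epsilon>' (g b)) w - free_hom (*) \<epsilon> w"])
          (auto intro!: module_pair.module_hom_sub module_pair.intro module.module_hom_free_hom
            ring_module fmod.module_axioms simp: module.free_hom_basis_vec[OF ring_module] g)
      then have "free_hom (*) (\<lambda>b. free_hom (*) \<epsilon>' (g b)) w \<in> I"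
        using module.subspace_add[OF ring_module F.ideal _ wI] by fastforce
      with mem show ?thesis by (simp add: G.cycles_0 module.free_hom_comp[OF ring_module])
    qed
    with g show "\<exists>g. P 0 g" unfolding P_def by blast
  next
    fix g i assume P: "P i g"
    have "\<exists>w. w \<in> free_on (B' (Suc i)) \<and> fcomp dg' (dg b) w = w \<and>
        free_hom fscale (d' (Suc i)) w = free_hom fscale g (d (Suc i) b)" if b: "b \<in> B (Suc i)" for b
    proof -
      have hom: "fcomp dg' (dg b) (free_hom fscale g (d (Suc i) b)) = free_hom fscale g (d (Suc i) b)"
        using P by (intro free_hom_homogeneous[OF _ F.diff_mem[OF b] F.diff_homogeneous[OF b]])
          (simp add: P_def)
      have img: "free_hom fscale g (d (Suc i) b) \<in> free_hom fscale (d' (Suc i)) ` free_on (B' (Suc i))"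
        using P F.diff_cycles[OF b] by (simp add: P_def G.cycles_def)
      show ?thesis
        by (rule free_graded.homogeneous_preimage[OF G.diff_homogeneous hom img]) blast+
    qed
    then obtain g' where g': "\<And>b. b \<in> B (Suc i) \<Longrightarrow> g' b \<in> free_on (B' (Suc i)) \<and>
        fcomp dg' (dg b) (g' b) = g' b \<and>
        free_hom fscale (d' (Suc i)) (g' b) = free_hom fscale g (d (Suc i) b)" by metis
    have "free_hom fscale g' w \<in> G.cycles (Suc i)" if w: "w \<in> F.cycles (Suc i)" for w
    proof -
      have w0: "w \<in> free_on (B (Suc i))" and "free_hom fscale (d (Suc i)) w = 0"
        using w by (auto simp: F.cycles_Suc)
      have mem: "free_hom fscale g' w \<in> free_on (B' (Suc i))"
        by (rule fmod.free_hom_mem[OF w0 subspace_free_on]) (use g' in blast)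
      have "free_hom fscale (d' (Suc i)) (free_hom fscale g' w) =
          free_hom fscale (\<lambda>b. free_hom fscale g (d (Suc i) b)) w"
        unfolding fmod.free_hom_comp by (rule fmod.free_hom_cong[OF w0]) (use g' in blast)
      also have "\<dots> = 0"
        unfolding fmod.free_hom_comp[symmetric] \<open>free_hom fscale (d (Suc i)) w = 0\<close> by simp
      finally show ?thesis using mem by (simp add: G.cycles_Suc)
    qed
    with g' show "\<exists>g'. P (Suc i) g' \<and> Q i g g'"
      unfolding P_def Q_def by (intro exI[of _ g']) blast
  qed
  then obtain g where "\<And>i. P i (g i)" "\<And>i. Q i (g i) (g (Suc i))" by blast
  then show ?thesis unfolding P_def Q_def comparison_map_def by (intro exI[of _ g]) blast
qed

locale minimal_resolution = graded_resolution I B dg \<epsilon> d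
  for I :: "('v::finite, 'k::field) mpoly set"
    and B :: "nat \<Rightarrow> 'b set" and dg :: "'b \<Rightarrow> nat"
    and \<epsilon> :: "'b \<Rightarrow> ('v, 'k) mpoly" and d :: "nat \<Rightarrow> 'b \<Rightarrow> ('b \<Rightarrow>\<^sub>0 ('v, 'k) mpoly)" +
  assumes diff_max: "b \<in> B (Suc i) \<Longrightarrow> d (Suc i) b \<in> max_free"
begin

lemma cycles_max: "cycles i \<subseteq> max_free"
proof -
  have "free_hom fscale (d (Suc i)) w \<in> max_free" if "w \<in> free_on (B (Suc i))" for w
    by (rule fmod.free_hom_mem[OF that subspace_max_free diff_max])
  then show ?thesis by (auto simp: cycles_def)
qed

text \<open>
  A chain map over the identity of \<open>R/I\<close> is homotopic to the identity, and the terms of a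
  homotopy lie in \<open>\<mm>F\<close> because the differentials of a minimal resolution do.
\<close>

lemma endomorphism_minus_id:
  assumes mem: "\<And>i b. b \<in> B i \<Longrightarrow> u i b \<in> free_on (B i)"
    and aug: "\<And>b. b \<in> B 0 \<Longrightarrow> free_hom (*) \<epsilon> (u 0 b) - \<epsilon> b \<in> I"
    and chain: "\<And>i b. b \<in> B (Suc i) \<Longrightarrow>
      free_hom fscale (d (Suc i)) (u (Suc i) b) = free_hom fscale (u i) (d (Suc i) b)"
    and b: "b \<in> B i"
  shows "u i b - basis_vec b \<in> max_free"
proof -
  have sub: "u i b - basis_vec b \<in> free_on (B i)" if "b \<in> B i" for i b
    using that by (intro fmod.subspace_diff[OF subspace_free_on] mem basis_vec_in_free_on)
  have zero: "u 0 b - basis_vec b \<in> cycles 0" if "b \<in> B 0" for b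
    using sub[OF that] aug[OF that]
    by (simp add: cycles_0 module.free_hom_diff[OF ring_module] module.free_hom_basis_vec[OF ring_module])
  \<comment> \<open>The homotopy equation is needed on cycles only, where its second term vanishes.\<close>
  define hty where "hty i h \<longleftrightarrow> (\<forall>b\<in>B i. h b \<in> free_on (B (Suc i))) \<and>
      (\<forall>w\<in>cycles i. free_hom fscale (d (Suc i)) (free_hom fscale h w) = free_hom fscale (u i) w - w)"
    for i and h :: "'b \<Rightarrow> ('b \<Rightarrow>\<^sub>0 ('v, 'k) mpoly)"
  have next_cycle: "u (Suc i) b - basis_vec b - free_hom fscale h (d (Suc i) b) \<in> cycles (Suc i)"
    if h: "hty i h" and b: "b \<in> B (Suc i)" for i h b
  proof -
    have "free_hom fscale h (d (Suc i) b) \<in> free_on (B (Suc i))"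
      using h by (intro fmod.free_hom_mem[OF diff_mem[OF b] subspace_free_on]) (simp add: hty_def)
    then show ?thesis
      using h diff_cycles[OF b] sub[OF b] chain[OF b]
      by (simp add: cycles_Suc fmod.subspace_diff[OF subspace_free_on] fmod.free_hom_diff hty_def)
  qed
  have ex: "\<exists>h. hty i h" for i
  proof (induction i)
    case 0
    have "\<exists>x. x \<in> free_on (B (Suc 0)) \<and> free_hom fscale (d (Suc 0)) x = u 0 b - basis_vec b"
      if "b \<in> B 0" for b
      using zero[OF that] by (auto simp: cycles_def)
    then obtain h where h: "\<And>b. b \<in> B 0 \<Longrightarrow> h b \<in> free_on (B (Suc 0))"
        "\<And>b. b \<in> B 0 \<Longrightarrow> free_hom fscale (d (Suc 0)) (h b) = u 0 b - basis_vec b" by metis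
    have "free_hom fscale (d (Suc 0)) (free_hom fscale h w) = free_hom fscale (u 0) w - w"
      if "w \<in> cycles 0" for w
    proof -
      have w: "w \<in> free_on (B 0)" using that by (simp add: cycles_0)
      have "free_hom fscale (d (Suc 0)) (free_hom fscale h w) = free_hom fscale (\<lambda>b. u 0 b - basis_vec b) w"
        unfolding fmod.free_hom_comp by (rule fmod.free_hom_cong[OF w h(2)])
      then show ?thesis by (simp add: fmod.free_hom_fun_diff free_hom_id)
    qed
    with h show ?case unfolding hty_def by blast
  next
    case (Suc i)
    then obtain h where h: "hty i h" by blast
    have "\<exists>x. x \<in> free_on (B (Suc (Suc i))) \<and> free_hom fscale (d (Suc (Suc i))) x =
        u (Suc i) b - basis_vec b - free_hom fscale h (d (Suc i) b)" if "b \<in> B (Suc i)" for b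
      using next_cycle[OF h that] by (auto simp: cycles_def)
    then obtain h' where h': "\<And>b. b \<in> B (Suc i) \<Longrightarrow> h' b \<in> free_on (B (Suc (Suc i)))"
        "\<And>b. b \<in> B (Suc i) \<Longrightarrow> free_hom fscale (d (Suc (Suc i))) (h' b) =
          u (Suc i) b - basis_vec b - free_hom fscale h (d (Suc i) b)" by metis
    have "free_hom fscale (d (Suc (Suc i))) (free_hom fscale h' w) = free_hom fscale (u (Suc i)) w - w"
      if "w \<in> cycles (Suc i)" for w
    proof -
      have w: "w \<in> free_on (B (Suc i))" and w0: "free_hom fscale (d (Suc i)) w = 0"
        using that by (simp_all add: cycles_Suc)
      have "free_hom fscale (d (Suc (Suc i))) (free_hom fscale h' w) =
          free_hom fscale (\<lambda>b. u (Suc i) b - basis_vec b - free_hom fscale h (d (Suc i) b)) w"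
        unfolding fmod.free_hom_comp by (rule fmod.free_hom_cong[OF w h'(2)])
      also have "\<dots> = free_hom fscale (u (Suc i)) w - w - free_hom fscale h (free_hom fscale (d (Suc i)) w)"
        by (simp add: fmod.free_hom_fun_diff free_hom_id fmod.free_hom_comp)
      finally show ?thesis using w0 by simp
    qed
    with h' show ?case unfolding hty_def by blast
  qed
  show ?thesis
  proof (cases i)
    case 0
    then show ?thesis using zero b cycles_max by blast
  next
    case (Suc j)
    obtain h where h: "hty j h" using ex by blast
    have "u (Suc j) b - basis_vec b - free_hom fscale h (d (Suc j) b) \<in> max_free"
      using next_cycle[OF h, of b] b Suc cycles_max by blast
    moreover have "free_hom fscale h (d (Suc j) b) \<in> max_free"
      using b Suc by (intro hom_max_free[OF fmod.module_hom_free_hom] diff_max) simp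
    ultimately show ?thesis
      using fmod.subspace_add[OF subspace_max_free] Suc by fastforce
  qed
qed

text \<open>
  Whatever degrees occur in step \<open>i\<close> of a minimal resolution occur in step \<open>i\<close> of every graded
  free resolution: otherwise the comparison maps would factor a basis element through \<open>\<mm>G\<close>.
\<close>

lemma degrees_of_minimal_resolution:
  assumes G: "graded_resolution I B' dg' \<epsilon>' d'" and b: "b \<in> B i"
  shows "\<exists>c\<in>B' i. dg' c = dg b"
proof (rule ccontr)
  assume no: "\<not> ?thesis"
  interpret G: graded_resolution I B' dg' \<epsilon>' d' by fact
  have F: "graded_resolution I B dg \<epsilon> d" by (rule graded_resolution_axioms)
  obtain g where "comparison_map I B dg \<epsilon> d B' dg' \<epsilon>' d' g"
    using comparison_map_exists[OF F G] by blast
  then have g: "\<And>i b. b \<in> B i \<Longrightarrow> g i b \<in> free_on (B' i)"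
    "\<And>i b. b \<in> B i \<Longrightarrow> fcomp dg' (dg b) (g i b) = g i b"
    "\<And>b. b \<in> B 0 \<Longrightarrow> free_hom (*) \<epsilon>' (g 0 b) - \<epsilon> b \<in> I"
    "\<And>i b. b \<in> B (Suc i) \<Longrightarrow>
      free_hom fscale (d' (Suc i)) (g (Suc i) b) = free_hom fscale (g i) (d (Suc i) b)"
    unfolding comparison_map_def by blast+
  obtain f where "comparison_map I B' dg' \<epsilon>' d' B dg \<epsilon> d f"
    using comparison_map_exists[OF G F] by blast
  then have f: "\<And>i b. b \<in> B' i \<Longrightarrow> f i b \<in> free_on (B i)"
    "\<And>b. b \<in> B' 0 \<Longrightarrow> free_hom (*) \<epsilon> (f 0 b) - \<epsilon>' b \<in> I"
    "\<And>i b. b \<in> B' (Suc i) \<Longrightarrow>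
      free_hom fscale (d (Suc i)) (f (Suc i) b) = free_hom fscale (f i) (d' (Suc i) b)"
    unfolding comparison_map_def by blast+
  define u where "u i b = free_hom fscale (f i) (g i b)" for i b
  have "u i b - basis_vec b \<in> max_free"
  proof (rule endomorphism_minus_id[OF _ _ _ b])
    show "u i b \<in> free_on (B i)" if "b \<in> B i" for i b
      unfolding u_def by (rule fmod.free_hom_mem[OF g(1)[OF that] subspace_free_on f(1)])
    show "free_hom (*) \<epsilon> (u 0 b) - \<epsilon> b \<in> I" if b: "b \<in> B 0" for b
    proof -
      have "free_hom (*) (\<lambda>c. free_hom (*) \<epsilon> (f 0 c) - \<epsilon>' c) (g 0 b) \<in> I"
        by (rule module.free_hom_mem[OF ring_module g(1)[OF b] ideal f(2)])
      then have "free_hom (*) \<epsilon> (u 0 b) - free_hom (*) \<epsilon>' (g 0 b) \<in> I"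
        by (simp add: module.free_hom_fun_diff[OF ring_module] u_def module.free_hom_comp[OF ring_module])
      from module.subspace_add[OF ring_module ideal this g(3)[OF b]] show ?thesis by simp
    qed
    show "free_hom fscale (d (Suc i)) (u (Suc i) b) = free_hom fscale (u i) (d (Suc i) b)"
      if b: "b \<in> B (Suc i)" for i b
    proof -
      have "free_hom fscale (d (Suc i)) (u (Suc i) b) =
          free_hom fscale (\<lambda>c. free_hom fscale (f i) (d' (Suc i) c)) (g (Suc i) b)"
        unfolding u_def fmod.free_hom_comp
        by (rule fmod.free_hom_cong[OF g(1)[OF b] f(3)])
      also have "\<dots> = free_hom fscale (f i) (free_hom fscale (d' (Suc i)) (g (Suc i) b))"
        by (simp add: fmod.free_hom_comp)
      also have "\<dots> = free_hom fscale (f i) (free_hom fscale (g i) (d (Suc i) b))"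
        by (simp add: g(4)[OF b])
      finally show ?thesis by (simp add: fmod.free_hom_comp u_def[abs_def])
    qed
  qed
  \<comment> \<open>A constant term of an entry of \<open>g i b\<close> would belong to a basis element of degree \<open>dg b\<close>.\<close>
  moreover have "g i b \<in> max_free"
    unfolding max_free_def mem_Collect_eq
  proof (rule allI, rule ccontr)
    fix c assume nz: "Poly_Mapping.lookup (Poly_Mapping.lookup (g i b) c) 0 \<noteq> 0"
    then have "dg' c = dg b"
      using lookup_lookup_fcomp[of dg' "dg b" "g i b" c 0] g(2)[OF b] by (simp split: if_splits)
    moreover have "c \<in> B' i"
      using free_on_lookup[OF g(1)[OF b], of c] nz by fastforce
    ultimately show False using no by blast
  qed
  then have "u i b \<in> max_free"
    unfolding u_def by (rule hom_max_free[OF fmod.module_hom_free_hom])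
  ultimately have "u i b - (u i b - basis_vec b) \<in> max_free"
    by (rule fmod.subspace_diff[OF subspace_max_free, rotated])
  moreover have "u i b - (u i b - basis_vec b) = basis_vec b" by (simp add: algebra_simps)
  ultimately have "basis_vec b \<in> (max_free :: ('b \<Rightarrow>\<^sub>0 ('v, 'k) mpoly) set)" by (simp only:)
  then show False unfolding max_free_def mem_Collect_eq
    by (auto simp: lookup_basis_vec dest!: spec[of _ b])
qed

end


section \<open>Minimal graded free resolutions exist\<close>

context graded_module
begin

text \<open>
  The field acts through the constants. Generators are chosen within a single degree, by linear
  algebra over the field.
\<close>

definition kscl :: "'k \<Rightarrow> 'm \<Rightarrow> 'm" where
  "kscl c x = scl (Poly_Mapping.single 0 c) x"

lemma vector_space_kscl: "vector_space kscl"
proof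
  fix a b x y
  show "kscl a (x + y) = kscl a x + kscl a y" by (simp add: kscl_def scale_right_distrib)
  show "kscl (a + b) x = kscl a x + kscl b x" by (simp add: kscl_def single_add scale_left_distrib)
  show "kscl a (kscl b x) = kscl (a * b) x" by (simp add: kscl_def mult_single)
  show "kscl 1 x = x" by (simp add: kscl_def)
qed

lemma kspan_subset:
  assumes "subspace L" "S \<subseteq> L"
  shows "module.span kscl S \<subseteq> L"
proof -
  interpret K: vector_space kscl by (rule vector_space_kscl)
  have "K.subspace L"
    using assms(1) by (intro K.subspaceI) (auto simp: kscl_def subspace_0 subspace_add subspace_scale)
  with assms(2) show ?thesis by (rule K.span_minimal)
qed

lemma ksubspace_homogeneous:
  assumes "subspace N"
  shows "module.subspace kscl {x \<in> N. hc n x = x}"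
proof -
  interpret K: vector_space kscl by (rule vector_space_kscl)
  show ?thesis
    using assms by (intro K.subspaceI)
      (auto simp: kscl_def hc_add hc_scl hcomp_single_0 subspace_0 subspace_add subspace_scale)
qed

text \<open>
  The elements of \<open>N\<close> of degree \<open>n\<close> have a finite basis modulo a submodule \<open>L\<close>: a basis of the
  part inside \<open>L\<close> is extended to one of the whole, and the added vectors are taken. In the
  application, \<open>L\<close> is what the elements of \<open>N\<close> of lower degrees generate.
\<close>

lemma degree_generators:
  assumes "subspace N" "subspace L" "finite T" "{x \<in> N. hc n x = x} \<subseteq> module.span kscl T"
  obtains C where "finite C" "C \<subseteq> {x \<in> N. hc n x = x}"
    "\<And>x. x \<in> N \<Longrightarrow> hc n x = x \<Longrightarrow> \<exists>c\<in>module.span kscl C. x - c \<in> L"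
    "\<And>a c. (\<Sum>c\<in>C. kscl (a c) c) \<in> L \<Longrightarrow> c \<in> C \<Longrightarrow> a c = 0"
proof -
  interpret K: vector_space kscl by (rule vector_space_kscl)
  define V where "V = {x \<in> N. hc n x = x}"
  have V: "K.subspace V" unfolding V_def by (rule ksubspace_homogeneous) fact
  obtain B0 where B0: "B0 \<subseteq> V \<inter> L" "K.independent B0" "V \<inter> L \<subseteq> K.span B0"
    by (rule K.maximal_independent_subset)
  obtain B where B: "B0 \<subseteq> B" "B \<subseteq> V" "K.independent B" "V \<subseteq> K.span B"
    using B0 by (meson K.maximal_independent_subset_extend le_inf_iff)
  have "B \<subseteq> K.span T"
    using B(2) assms(4) unfolding V_def by blast
  then have "finite B"
    using K.independent_span_bound[OF assms(3) B(3)] by blast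
  have gen: "\<exists>c\<in>K.span (B - B0). x - c \<in> L" if "x \<in> V" for x
  proof -
    have "x \<in> K.span ((B - B0) \<union> B0)"
      using that B by (metis Un_Diff_cancel2 Un_absorb2 subsetD)
    then obtain c y where "x = c + y" "c \<in> K.span (B - B0)" "y \<in> K.span B0"
      unfolding K.span_Un by blast
    moreover have "y \<in> L"
      using kspan_subset[OF assms(2), of B0] B0(1) \<open>y \<in> K.span B0\<close> by blast
    ultimately show ?thesis by (intro bexI[of _ c]) auto
  qed
  have indep: "a c = 0" if sum: "(\<Sum>c\<in>B - B0. kscl (a c) c) \<in> L" and c: "c \<in> B - B0" for a c
  proof -
    let ?z = "\<Sum>c\<in>B - B0. kscl (a c) c"
    have "?z \<in> V"
      using B(2) by (intro K.subspace_sum[OF V] K.subspace_scale[OF V]) auto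
    with sum B0(3) have "?z \<in> K.span B0" by blast
    moreover have "finite B0" using B(1) \<open>finite B\<close> finite_subset by blast
    ultimately obtain r where r: "?z = (\<Sum>v\<in>B0. kscl (r v) v)"
      using K.span_finite[of B0] by auto
    \<comment> \<open>The two expansions of the same vector combine into one linear relation on \<open>B\<close>.\<close>
    define u where "u v = (if v \<in> B0 then - r v else a v)" for v
    have "(\<Sum>v\<in>B. kscl (u v) v) = (\<Sum>v\<in>B - B0. kscl (u v) v) + (\<Sum>v\<in>B0. kscl (u v) v)"
      using B(1) \<open>finite B\<close> by (rule sum.subset_diff)
    also have "(\<Sum>v\<in>B - B0. kscl (u v) v) = ?z"
      by (rule sum.cong) (auto simp: u_def)
    also have "(\<Sum>v\<in>B0. kscl (u v) v) = - (\<Sum>v\<in>B0. kscl (r v) v)"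
      unfolding sum_negf[symmetric] by (rule sum.cong) (auto simp: u_def)
    finally have "(\<Sum>v\<in>B. kscl (u v) v) = 0" using r by simp
    then have "u c = 0"
      using K.independentD[OF B(3) \<open>finite B\<close>] c by blast
    then show ?thesis using c by (simp add: u_def)
  qed
  show ?thesis
  proof (rule that[of "B - B0"])
    show "finite (B - B0)" using \<open>finite B\<close> by blast
    show "B - B0 \<subseteq> {x \<in> N. hc n x = x}" using B(2) by (auto simp: V_def)
  qed (use gen indep in \<open>auto simp: V_def\<close>)
qed

text \<open>
  In each degree, take a basis of the elements of \<open>N\<close> modulo those generated in lower degrees.
  Together these generate \<open>N\<close>, by induction on the degree. In a relation between them, a constant
  coefficient would give, in the degree of its generator, a linear dependence modulo the elements
  generated in lower degrees; hence all coefficients lie in \<open>\<mm>\<close>.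
\<close>

lemma minimal_generators:
  assumes N: "subspace N" "\<And>x n. x \<in> N \<Longrightarrow> hc n x \<in> N"
    and fin: "\<And>n. \<exists>T. finite T \<and> {x \<in> N. hc n x = x} \<subseteq> module.span kscl T"
  obtains \<gamma> \<delta> where
    "\<And>b. b \<in> basis_index \<gamma> \<Longrightarrow> \<delta> b \<in> N \<and> hc (fst b) (\<delta> b) = \<delta> b"
    "free_hom scl \<delta> ` free_on (basis_index \<gamma>) = N"
    "{w \<in> free_on (basis_index \<gamma>). free_hom scl \<delta> w = 0} \<subseteq> max_free"
proof -
  interpret K: vector_space kscl by (rule vector_space_kscl)
  define V where "V n = {x \<in> N. hc n x = x}" for n
  define L where "L n = span (\<Union>k<n. V k)" for n
  have L: "subspace (L n)" for n by (simp add: L_def)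
  define good where "good n C \<longleftrightarrow> finite C \<and> C \<subseteq> V n \<and> (\<forall>x\<in>V n. \<exists>c\<in>K.span C. x - c \<in> L n) \<and>
      (\<forall>a c. (\<Sum>c\<in>C. kscl (a c) c) \<in> L n \<longrightarrow> c \<in> C \<longrightarrow> a c = 0)" for n C
  have "\<exists>C. good n C" for n
  proof -
    obtain T where "finite T" "{x \<in> N. hc n x = x} \<subseteq> K.span T" using fin by blast
    then show ?thesis
    proof (rule degree_generators[OF N(1) L[of n]])
      fix C
      assume C: "finite C" "C \<subseteq> {x \<in> N. hc n x = x}"
        and gen: "\<And>x. x \<in> N \<Longrightarrow> hc n x = x \<Longrightarrow> \<exists>c\<in>K.span C. x - c \<in> L n"
        and indep: "\<And>a c. (\<Sum>c\<in>C. kscl (a c) c) \<in> L n \<Longrightarrow> c \<in> C \<Longrightarrow> a c = 0"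
      show ?thesis
        unfolding good_def
      proof (intro exI[of _ C] conjI allI ballI impI)
        show "\<exists>c\<in>K.span C. x - c \<in> L n" if "x \<in> V n" for x
          using gen that by (simp add: V_def)
        show "a c = 0" if "(\<Sum>c\<in>C. kscl (a c) c) \<in> L n" "c \<in> C" for a c
          using indep[OF that] .
      qed (use C in \<open>simp_all add: V_def\<close>)
    qed
  qed
  then obtain C where "\<And>n. good n (C n)" by metis
  then have C: "\<And>n. finite (C n)" "\<And>n. C n \<subseteq> V n"
      "\<And>n x. x \<in> V n \<Longrightarrow> \<exists>c\<in>K.span (C n). x - c \<in> L n"
      "\<And>n a c. (\<Sum>c\<in>C n. kscl (a c) c) \<in> L n \<Longrightarrow> c \<in> C n \<Longrightarrow> a c = 0"
    unfolding good_def by blast+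
  have "\<exists>e. bij_betw e {..<card (C n)} (C n)" for n
    using ex_bij_betw_nat_finite[OF C(1)[of n]] by (simp add: atLeast0LessThan)
  then obtain e where e: "\<And>n. bij_betw (e n) {..<card (C n)} (C n)" by metis
  define \<gamma> where "\<gamma> n = card (C n)" for n
  define \<delta> where "\<delta> b = e (fst b) (snd b)" for b
  let ?B = "basis_index \<gamma>"
  have \<delta>V: "\<delta> b \<in> V (fst b)" if "b \<in> ?B" for b
  proof -
    have "e (fst b) (snd b) \<in> C (fst b)"
      using that bij_betw_apply[OF e] by (auto simp: basis_index_def \<gamma>_def)
    then show ?thesis using C(2) by (auto simp: \<delta>_def)
  qed
  have C\<delta>: "C n \<subseteq> \<delta> ` ?B" for n
  proof
    fix c assume "c \<in> C n"
    then obtain l where "l < card (C n)" "c = e n l"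
      using e[of n] by (auto simp: bij_betw_def)
    then show "c \<in> \<delta> ` ?B"
      by (intro image_eqI[of _ _ "(n, l)"]) (auto simp: \<delta>_def basis_index_def \<gamma>_def)
  qed
  let ?Im = "free_hom scl \<delta> ` free_on ?B"
  have Im: "subspace ?Im"
    by (intro module_hom.subspace_image[OF module_hom_free_hom] subspace_free_on)
  have \<delta>Im: "\<delta> ` ?B \<subseteq> ?Im"
  proof
    fix x assume "x \<in> \<delta> ` ?B"
    then obtain b where "b \<in> ?B" "x = \<delta> b" by blast
    then show "x \<in> ?Im"
      by (intro image_eqI[of _ _ "basis_vec b"]) (auto intro: basis_vec_in_free_on)
  qed
  have VIm: "V n \<subseteq> ?Im" for n
  proof (induction n rule: less_induct)
    case (less n)
    have LIm: "L n \<subseteq> ?Im"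
      unfolding L_def using less by (intro span_minimal[OF _ Im]) auto
    show ?case
    proof
      fix x assume "x \<in> V n"
      then obtain c where c: "c \<in> K.span (C n)" "x - c \<in> L n" using C(3) by blast
      have "c \<in> ?Im"
        using kspan_subset[OF Im, of "C n"] C\<delta>[of n] \<delta>Im c(1) by blast
      moreover have "x - c \<in> ?Im" using c(2) LIm by blast
      ultimately show "x \<in> ?Im" using subspace_add[OF Im, of c "x - c"] by simp
    qed
  qed
  have image: "?Im = N"
  proof
    show "?Im \<subseteq> N"
      using \<delta>V by (auto intro!: free_hom_mem[OF _ N(1)] simp: V_def)
    show "N \<subseteq> ?Im"
    proof
      fix x assume x: "x \<in> N"
      obtain M where M: "x = (\<Sum>n<M. hc n x)" using hc_sum_finite by blast
      have "(\<Sum>n<M. hc n x) \<in> ?Im"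
      proof (rule subspace_sum[OF Im])
        fix n
        have "hc n x \<in> V n" using N(2)[OF x] by (simp add: V_def hc_hc)
        then show "hc n x \<in> ?Im" using VIm by blast
      qed
      with M show "x \<in> ?Im" by simp
    qed
  qed
  have kernel: "Poly_Mapping.lookup (Poly_Mapping.lookup w b) 0 = 0"
    if w: "w \<in> free_on ?B" and ker: "free_hom scl \<delta> w = 0" for w b
  proof (cases "b \<in> ?B")
    case False
    then have "Poly_Mapping.lookup w b = 0" using w by (simp add: free_on_lookup)
    then show ?thesis by simp
  next
    case True
    define n where "n = fst b"
    let ?w = "fcomp fst n w"
    let ?top = "Pair n ` {..<\<gamma> n}"
    define A where "A = Poly_Mapping.keys ?w \<union> ?top"
    define a where "a c = Poly_Mapping.lookup (Poly_Mapping.lookup w (n, the_inv_into {..<\<gamma> n} (e n) c)) 0" for c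
    have inj: "inj_on (Pair n) {..<\<gamma> n}" by (rule inj_onI) simp
    have AB: "A \<subseteq> ?B"
      using fcomp_free_on[OF w, of fst n] by (auto simp: A_def free_on_def basis_index_def)
    \<comment> \<open>In degree \<open>n\<close>, the generators of degree \<open>n\<close> have constant coefficients, and the others lie in \<open>L n\<close>.\<close>
    have "0 = hc n (free_hom scl \<delta> w)" using ker by simp
    also have "\<dots> = free_hom scl \<delta> ?w"
      using \<delta>V by (intro hc_free_hom[OF _ w]) (auto simp: V_def)
    also have "\<dots> = (\<Sum>b\<in>A. scl (Poly_Mapping.lookup ?w b) (\<delta> b))"
      by (rule free_hom_superset) (auto simp: A_def)
    also have "\<dots> = (\<Sum>b\<in>A - ?top. scl (Poly_Mapping.lookup ?w b) (\<delta> b))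
        + (\<Sum>b\<in>?top. scl (Poly_Mapping.lookup ?w b) (\<delta> b))"
      by (rule sum.subset_diff) (auto simp: A_def)
    also have "(\<Sum>b\<in>?top. scl (Poly_Mapping.lookup ?w b) (\<delta> b)) =
        (\<Sum>l<\<gamma> n. kscl (a (e n l)) (e n l))"
      unfolding sum.reindex[OF inj]
    proof (simp add: o_def, rule sum.cong[OF refl])
      fix l assume "l \<in> {..<\<gamma> n}"
      then have "the_inv_into {..<\<gamma> n} (e n) (e n l) = l"
        using e[of n] by (intro the_inv_into_f_f) (auto simp: bij_betw_def \<gamma>_def)
      then show "scl (Poly_Mapping.lookup ?w (n, l)) (\<delta> (n, l)) = kscl (a (e n l)) (e n l)"
        by (simp add: lookup_fcomp hcomp_zero_degree \<delta>_def kscl_def a_def)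
    qed
    also have "\<dots> = (\<Sum>c\<in>C n. kscl (a c) c)"
      using e[of n] unfolding \<gamma>_def by (rule sum.reindex_bij_betw)
    finally have "(\<Sum>c\<in>C n. kscl (a c) c) = - (\<Sum>b\<in>A - ?top. scl (Poly_Mapping.lookup ?w b) (\<delta> b))"
      by (simp add: eq_neg_iff_add_eq_0 add.commute)
    also have "\<dots> \<in> L n"
    proof (intro subspace_neg[OF L] subspace_sum[OF L])
      fix b assume b: "b \<in> A - ?top"
      show "scl (Poly_Mapping.lookup ?w b) (\<delta> b) \<in> L n"
      proof (cases "fst b < n")
        case True
        then have "\<delta> b \<in> L n"
          using \<delta>V[of b] b AB unfolding L_def by (intro span_base) auto
        then show ?thesis by (rule subspace_scale[OF L])
      next
        case False
        have "fst b \<noteq> n"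
          using b AB by (cases b) (auto simp: basis_index_def)
        then show ?thesis
          using False by (simp add: lookup_fcomp subspace_0[OF L])
      qed
    qed
    finally have "a c = 0" if "c \<in> C n" for c
      using C(4) that by blast
    moreover have "snd b < \<gamma> n" using True by (auto simp: n_def basis_index_def)
    ultimately have "a (e n (snd b)) = 0"
      using bij_betw_apply[OF e[of n]] by (simp add: \<gamma>_def)
    moreover have "the_inv_into {..<\<gamma> n} (e n) (e n (snd b)) = snd b"
      using e[of n] \<open>snd b < \<gamma> n\<close> by (intro the_inv_into_f_f) (auto simp: bij_betw_def \<gamma>_def)
    ultimately show ?thesis by (simp add: a_def n_def)
  qed
  show ?thesis
  proof (rule that[of \<gamma> \<delta>])
    show "\<delta> b \<in> N \<and> hc (fst b) (\<delta> b) = \<delta> b" if "b \<in> ?B" for b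
      using \<delta>V[OF that] by (simp add: V_def)
    show "?Im = N" by (rule image)
    show "{w \<in> free_on ?B. free_hom scl \<delta> w = 0} \<subseteq> max_free"
      using kernel by (auto simp: max_free_def)
  qed
qed

end

lemma finite_mon_deg_le: "finite {t :: 'v::finite \<Rightarrow>\<^sub>0 nat. mon_deg t \<le> n}"
proof -
  have "Poly_Mapping.lookup t v \<le> mon_deg t" for t :: "'v \<Rightarrow>\<^sub>0 nat" and v
    unfolding mon_deg_def by (rule member_le_sum) auto
  then have "Poly_Mapping.lookup ` {t :: 'v \<Rightarrow>\<^sub>0 nat. mon_deg t \<le> n}
      \<subseteq> {f. \<forall>x. (x \<in> UNIV \<longrightarrow> f x \<in> {..n}) \<and> (x \<notin> UNIV \<longrightarrow> f x = 0)}"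
    by (auto intro: order_trans)
  then have "finite (Poly_Mapping.lookup ` {t :: 'v \<Rightarrow>\<^sub>0 nat. mon_deg t \<le> n})"
    by (rule finite_subset) (rule finite_set_of_finite_funs; simp)
  then show ?thesis
    by (rule finite_imageD) (auto intro!: inj_onI poly_mapping_eqI)
qed

text \<open>
  Only basis elements of degree at most \<open>n\<close> contribute to degree \<open>n\<close>, so a free module of
  infinite rank is admissible as long as it has finitely many basis elements in each degree.
\<close>

lemma finite_dimensional_degree_parts:
  fixes dg :: "'b \<Rightarrow> nat"
  assumes "finite {b \<in> B. dg b \<le> n}"
  shows "\<exists>T. finite T \<and> {x \<in> free_on B :: ('b \<Rightarrow>\<^sub>0 ('v::finite, 'k::field) mpoly) set. fcomp dg n x = x}
    \<subseteq> module.span (graded_module.kscl fscale) T"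
proof -
  interpret K: vector_space "graded_module.kscl (fscale :: ('v, 'k) mpoly \<Rightarrow> ('b \<Rightarrow>\<^sub>0 ('v, 'k) mpoly) \<Rightarrow> _)"
    by (rule free_graded.vector_space_kscl)
  let ?e = "\<lambda>(b, t). Poly_Mapping.single b (Poly_Mapping.single t 1) :: 'b \<Rightarrow>\<^sub>0 ('v, 'k) mpoly"
  let ?T = "?e ` ({b \<in> B. dg b \<le> n} \<times> {t. mon_deg t \<le> n})"
  have "x \<in> K.span ?T" if x: "x \<in> free_on B" "fcomp dg n x = x" for x
  proof -
    have single_sum: "Poly_Mapping.single b (sum f A) = (\<Sum>a\<in>A. Poly_Mapping.single b (f a))"
      for b :: 'b and f :: "('v \<Rightarrow>\<^sub>0 nat) \<Rightarrow> ('v, 'k) mpoly" and A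
      by (induction A rule: infinite_finite_induct) (auto simp: single_add)
    have "x = (\<Sum>b\<in>Poly_Mapping.keys x. Poly_Mapping.single b (Poly_Mapping.lookup x b))"
      by (rule poly_mapping_eqI) (simp add: lookup_sum lookup_single when_def in_keys_iff)
    also have "\<dots> = (\<Sum>b\<in>Poly_Mapping.keys x. \<Sum>t\<in>Poly_Mapping.keys (Poly_Mapping.lookup x b).
        Poly_Mapping.single b (Poly_Mapping.single t (Poly_Mapping.lookup (Poly_Mapping.lookup x b) t)))"
      by (intro sum.cong refl) (metis sum_single single_sum)
    also have "\<dots> \<in> K.span ?T"
    proof (intro K.span_sum)
      fix b t
      assume b: "b \<in> Poly_Mapping.keys x" and t: "t \<in> Poly_Mapping.keys (Poly_Mapping.lookup x b)"
      let ?c = "Poly_Mapping.lookup (Poly_Mapping.lookup x b) t"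
      have "?c \<noteq> 0" using t by (simp add: in_keys_iff)
      then have "dg b + mon_deg t = n"
        using lookup_lookup_fcomp[of dg n x b t] x(2) by (auto split: if_splits)
      moreover have "b \<in> B" using b x(1) by (auto simp: free_on_def)
      ultimately have "?e (b, t) \<in> ?T" by (intro imageI) auto
      moreover have "Poly_Mapping.single b (Poly_Mapping.single t ?c) = graded_module.kscl fscale ?c (?e (b, t))"
        by (rule poly_mapping_eqI) (simp add: free_graded.kscl_def lookup_single when_def mult_single)
      ultimately show "Poly_Mapping.single b (Poly_Mapping.single t ?c) \<in> K.span ?T"
        by (simp add: K.span_scale K.span_base)
    qed
    finally show ?thesis .
  qed
  moreover have "finite ?T"
    using assms by (intro finite_imageI finite_cartesian_product finite_mon_deg_le)
  ultimately show ?thesis by (intro exI[of _ ?T]) blast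
qed

lemma finite_basis_index_le: "finite {b \<in> basis_index \<beta>. fst b \<le> n}"
proof (rule finite_subset)
  show "{b \<in> basis_index \<beta>. fst b \<le> n} \<subseteq> Sigma {..n} (\<lambda>j. {..<\<beta> j})"
    by (auto simp: basis_index_def)
qed simp

lemma free_module_eq: "free_module \<beta> = free_on (basis_index \<beta>)"
  by (simp add: free_module_def free_on_def)

lemma hcomp_one: "hcomp 0 1 = 1"
  using hcomp_single_0[of 0 1] by simp

text \<open>
  The kernels of minimal covers are graded submodules of \<open>\<mm>F\<close>, so covering each kernel minimally
  in turn yields a resolution all of whose differentials have entries in \<open>\<mm>\<close>.
\<close>

lemma minimal_graded_free_resolution_exists:
  fixes I :: "('v::finite, 'k::field) mpoly set"
  assumes "homogeneous_ideal I"
  shows "\<exists>\<beta> \<epsilon> d. minimal_graded_free_resolution I \<beta> \<epsilon> d"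
proof -
  have I: "module.subspace (*) I" and hom: "\<And>p n. p \<in> I \<Longrightarrow> hcomp n p \<in> I"
    using assms by (auto simp: homogeneous_ideal_def)
  \<comment> \<open>The minimal cover of \<open>R/I\<close> is \<open>R\<close>, except that it is \<open>0\<close> if \<open>I = R\<close>.\<close>
  define \<beta>0 :: "nat \<Rightarrow> nat" where "\<beta>0 j = (if j = 0 \<and> 1 \<notin> I then 1 else 0)" for j
  let ?\<epsilon> = "(\<lambda>_. 1) :: nat \<times> nat \<Rightarrow> ('v, 'k) mpoly"
  define N0 where "N0 = {w \<in> free_module \<beta>0. free_hom (*) ?\<epsilon> w \<in> I}"
  have fst0: "fst b = 0" if "b \<in> basis_index \<beta>0" for b
    using that by (auto simp: basis_index_def \<beta>0_def split: if_splits)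
  define ok where "ok N \<beta> \<longleftrightarrow> N \<subseteq> free_on (basis_index \<beta>) \<and> module.subspace fscale N \<and>
      (\<forall>x\<in>N. \<forall>n. fcomp fst n x \<in> N) \<and> N \<subseteq> max_free"
    for N :: "('v, 'k) free_elem set" and \<beta>
  have ok0: "ok N0 \<beta>0"
    unfolding ok_def
  proof (intro conjI ballI allI)
    show "N0 \<subseteq> free_on (basis_index \<beta>0)" by (auto simp: N0_def free_module_eq)
    have "fmod.subspace {w. free_hom (*) ?\<epsilon> w \<in> I}"
      by (rule module_hom.subspace_linear_preimage[OF module.module_hom_free_hom[OF ring_module] I])
    from fmod.subspace_inter[OF subspace_free_on this]
    show "fmod.subspace N0" by (simp add: N0_def free_module_eq Int_def)
    show "fcomp fst n x \<in> N0" if "x \<in> N0" for x n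
    proof -
      have "free_hom (*) ?\<epsilon> (fcomp fst n x) = hcomp n (free_hom (*) ?\<epsilon> x)"
        by (rule graded_module.hc_free_hom[OF poly_graded, symmetric, where B = "basis_index \<beta>0"])
          (use that in \<open>auto simp: N0_def free_module_eq fst0 hcomp_one\<close>)
      then show ?thesis using that hom by (simp add: N0_def free_module_eq fcomp_free_on)
    qed
    show "N0 \<subseteq> max_free"
    proof
      fix w assume w: "w \<in> N0"
      show "w \<in> max_free"
        unfolding max_free_def mem_Collect_eq
      proof
        fix b
        show "Poly_Mapping.lookup (Poly_Mapping.lookup w b) 0 = 0"
        proof (rule ccontr)
          assume nz: "\<not> ?thesis"
          let ?c = "Poly_Mapping.lookup (Poly_Mapping.lookup w b) 0"
          have "b \<in> basis_index \<beta>0"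
            using w nz free_onD[of w "basis_index \<beta>0" b] lookup_not_eq_zero_eq_in_keys[of w b]
            by (fastforce simp: N0_def free_module_eq)
          then have I1: "1 \<notin> I" and b: "b = (0, 0)" and keys: "Poly_Mapping.keys w \<subseteq> {b}"
            using w by (auto simp: basis_index_def \<beta>0_def N0_def free_module_def split: if_splits)
          have "Poly_Mapping.lookup w b = free_hom (*) ?\<epsilon> w"
            by (subst module.free_hom_superset[OF ring_module _ keys]) auto
          then have "hcomp 0 (Poly_Mapping.lookup w b) \<in> I"
            using w hom by (simp add: N0_def)
          then have "Poly_Mapping.single 0 (inverse ?c) * Poly_Mapping.single 0 ?c \<in> I"
            unfolding hcomp_zero_degree
            by (rule module.subspace_scale[OF ring_module I])
          then show False using I1 nz by (simp add: mult_single)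
        qed
      qed
    qed
  qed
  \<comment> \<open>A state consists of a submodule, the ranks of the free module that contains it, and a map onto the previous submodule.\<close>
  define step where "step s s' \<longleftrightarrow>
      (case s of (N, \<beta>, _) \<Rightarrow> case s' of (N', \<beta>', \<delta>) \<Rightarrow>
        (\<forall>b\<in>basis_index \<beta>'. \<delta> b \<in> N \<and> fcomp fst (fst b) (\<delta> b) = \<delta> b) \<and>
        free_hom fscale \<delta> ` free_on (basis_index \<beta>') = N \<and>
        N' = {w \<in> free_on (basis_index \<beta>'). free_hom fscale \<delta> w = 0})"
    for s s' :: "('v, 'k) free_elem set \<times> (nat \<Rightarrow> nat) \<times> (nat \<times> nat \<Rightarrow> ('v, 'k) free_elem)"
  define okS where "okS s \<longleftrightarrow> ok (fst s) (fst (snd s))"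
    for s :: "('v, 'k) free_elem set \<times> (nat \<Rightarrow> nat) \<times> (nat \<times> nat \<Rightarrow> ('v, 'k) free_elem)"
  have step: "\<exists>s'. okS s' \<and> step s s'" if "okS s" for s
  proof -
    obtain N \<beta> \<delta>0 where s: "s = (N, \<beta>, \<delta>0)" by (rule prod_cases3)
    have N: "N \<subseteq> free_on (basis_index \<beta>)" "fmod.subspace N" "\<And>x n. x \<in> N \<Longrightarrow> fcomp fst n x \<in> N"
      using that by (auto simp: s okS_def ok_def)
    have fin: "\<exists>T. finite T \<and> {x \<in> N. fcomp fst n x = x} \<subseteq> module.span (graded_module.kscl fscale) T" for n
    proof -
      obtain T :: "('v, 'k) free_elem set" where "finite T"
          "{x \<in> free_on (basis_index \<beta>). fcomp fst n x = x}
            \<subseteq> module.span (graded_module.kscl fscale) T"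
        using finite_dimensional_degree_parts[OF finite_basis_index_le[of \<beta> n]] by blast
      with N(1) show ?thesis by (intro exI[of _ T]) blast
    qed
    show ?thesis
    proof (rule free_graded.minimal_generators[of N fst, OF N(2,3) fin])
      fix \<gamma> \<delta>
      assume g: "\<And>b. b \<in> basis_index \<gamma> \<Longrightarrow> \<delta> b \<in> N \<and> fcomp fst (fst b) (\<delta> b) = \<delta> b"
        "free_hom fscale \<delta> ` free_on (basis_index \<gamma>) = N"
        "{w \<in> free_on (basis_index \<gamma>). free_hom fscale \<delta> w = 0} \<subseteq> max_free"
      let ?N = "{w \<in> free_on (basis_index \<gamma>). free_hom fscale \<delta> w = 0}"
      have "ok ?N \<gamma>"
        unfolding ok_def
      proof (intro conjI ballI allI)
        have "fmod.subspace {w. free_hom fscale \<delta> w = 0}"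
          by (rule module_hom.subspace_kernel[OF fmod.module_hom_free_hom])
        from fmod.subspace_inter[OF subspace_free_on this]
        show "fmod.subspace ?N" by (simp add: Int_def)
        show "fcomp fst n x \<in> ?N" if "x \<in> ?N" for x n
          using free_graded.hc_free_hom[of "basis_index \<gamma>" fst fst \<delta> x n] that g(1)
          by (simp add: fcomp_free_on)
      qed (use g(3) in auto)
      with g show ?thesis
        unfolding step_def s okS_def by (intro exI[of _ "(?N, \<gamma>, \<delta>)"]) auto
    qed
  qed
  obtain \<sigma> where \<sigma>0: "\<sigma> 0 = (N0, \<beta>0, undefined)"
    and \<sigma>: "\<And>i. okS (\<sigma> i)" "\<And>i. step (\<sigma> i) (\<sigma> (Suc i))"
  proof -
    have "\<exists>\<sigma>. \<forall>i. (okS (\<sigma> i) \<and> (i = 0 \<longrightarrow> \<sigma> i = (N0, \<beta>0, undefined))) \<and> step (\<sigma> i) (\<sigma> (Suc i))"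
    proof (rule dependent_nat_choice)
      show "\<exists>s. okS s \<and> (0 = 0 \<longrightarrow> s = (N0, \<beta>0, undefined))"
        using ok0 by (simp add: okS_def)
      show "\<exists>s'. (okS s' \<and> (Suc i = 0 \<longrightarrow> s' = (N0, \<beta>0, undefined))) \<and> step s s'"
        if "okS s \<and> (i = 0 \<longrightarrow> s = (N0, \<beta>0, undefined))" for s i
        using step[of s] that by simp
    qed
    then show ?thesis using that by blast
  qed
  define N where "N i = fst (\<sigma> i)" for i
  define \<beta> where "\<beta> i = fst (snd (\<sigma> i))" for i
  define d where "d i = snd (snd (\<sigma> i))" for i
  have ok: "ok (N i) (\<beta> i)" for i
    using \<sigma>(1)[of i] by (simp add: N_def \<beta>_def okS_def)
  have st: "\<forall>b\<in>basis_index (\<beta> (Suc i)). d (Suc i) b \<in> N i \<and> fcomp fst (fst b) (d (Suc i) b) = d (Suc i) b"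
      "free_hom fscale (d (Suc i)) ` free_on (basis_index (\<beta> (Suc i))) = N i"
      "N (Suc i) = {w \<in> free_on (basis_index (\<beta> (Suc i))). free_hom fscale (d (Suc i)) w = 0}" for i
    using \<sigma>(2)[of i] by (auto simp: N_def \<beta>_def d_def step_def split: prod.splits)
  have zero: "\<beta> 0 = \<beta>0" "N 0 = N0" using \<sigma>0 by (simp_all add: N_def \<beta>_def)
  have "minimal_graded_free_resolution I \<beta> ?\<epsilon> d"
    unfolding minimal_graded_free_resolution_def graded_free_resolution_def
      free_scale_eq_fscale free_homogeneous_iff homogeneous_iff free_module_eq
  proof (intro conjI allI ballI impI)
    show "hcomp (fst b) 1 = 1" if "b \<in> basis_index (\<beta> 0)" for b
      using that fst0 by (simp add: zero hcomp_one)
    show "d (Suc i) b \<in> free_on (basis_index (\<beta> i))" "fcomp fst (fst b) (d (Suc i) b) = d (Suc i) b"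
      if "b \<in> basis_index (\<beta> (Suc i))" for i b
      using st(1)[of i] ok[of i] that by (auto simp: ok_def)
    show "\<exists>w\<in>free_on (basis_index (\<beta> 0)). p - free_hom (*) ?\<epsilon> w \<in> I" for p
    proof (cases "1 \<in> I")
      case True
      from module.subspace_scale[OF ring_module I this, of p] show ?thesis
        by (intro bexI[of _ 0]) (auto simp: free_on_def free_hom_def)
    next
      case False
      then have b: "(0, 0) \<in> basis_index (\<beta> 0)" by (simp add: zero \<beta>0_def basis_index_def)
      show ?thesis
      proof (intro bexI)
        show "fscale p (basis_vec (0, 0)) \<in> free_on (basis_index (\<beta> 0))"
          by (intro fmod.subspace_scale[OF subspace_free_on] basis_vec_in_free_on b)
        show "p - free_hom (*) ?\<epsilon> (fscale p (basis_vec (0, 0))) \<in> I"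
          by (simp add: module.free_hom_scale[OF ring_module] module.free_hom_basis_vec[OF ring_module]
              module.subspace_0[OF ring_module I])
      qed
    qed
    show "free_hom fscale (d 1) ` free_on (basis_index (\<beta> 1)) =
        {w \<in> free_on (basis_index (\<beta> 0)). free_hom (*) ?\<epsilon> w \<in> I}"
      using st(2)[of 0] by (simp add: zero N0_def free_module_eq)
    show "free_hom fscale (d (Suc i)) ` free_on (basis_index (\<beta> (Suc i))) =
        {w \<in> free_on (basis_index (\<beta> i)). free_hom fscale (d i) w = 0}" if "1 \<le> i" for i
      using st(2)[of i] st(3)[of "i - 1"] that by simp
    show "Poly_Mapping.lookup (d (Suc i) b) c \<in> ideal_gen (range var)"
      if "b \<in> basis_index (\<beta> (Suc i))" for i b c
    proof -
      have "d (Suc i) b \<in> max_free" using st(1)[of i] ok[of i] that by (auto simp: ok_def)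
      then show ?thesis unfolding max_free_iff by (rule spec)
    qed
  qed
  then show ?thesis by blast
qed


section \<open>The horseshoe lemma for the multiplication sequence\<close>

text \<open>
  The inclusions of the summands of the direct sum of two free modules, which is the free module
  over the disjoint union of the bases.
\<close>

definition inl_map :: "('a \<Rightarrow>\<^sub>0 'r::comm_ring_1) \<Rightarrow> ('a + 'c \<Rightarrow>\<^sub>0 'r)" where
  "inl_map = free_hom fscale (\<lambda>a. basis_vec (Inl a))"

definition inr_map :: "('c \<Rightarrow>\<^sub>0 'r::comm_ring_1) \<Rightarrow> ('a + 'c \<Rightarrow>\<^sub>0 'r)" where
  "inr_map = free_hom fscale (\<lambda>c. basis_vec (Inr c))"

lemma lookup_free_hom:
  "Poly_Mapping.lookup (free_hom fscale \<phi> w) x =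
    (\<Sum>b\<in>Poly_Mapping.keys w. Poly_Mapping.lookup w b * Poly_Mapping.lookup (\<phi> b) x)"
  by (simp add: free_hom_def lookup_sum)

lemma lookup_injection:
  assumes "inj f"
  shows "Poly_Mapping.lookup (free_hom fscale (\<lambda>a. basis_vec (f a)) w) (f a) = Poly_Mapping.lookup w a"
proof -
  have "Poly_Mapping.lookup (free_hom fscale (\<lambda>a. basis_vec (f a)) w) (f a) =
      (\<Sum>b\<in>Poly_Mapping.keys w. if b = a then Poly_Mapping.lookup w b else 0)"
    unfolding lookup_free_hom
    by (rule sum.cong) (simp_all add: lookup_basis_vec inj_eq[OF assms])
  then show ?thesis by (simp add: in_keys_iff)
qed

lemma lookup_inl_map [simp]:
  "Poly_Mapping.lookup (inl_map w) (Inl a) = Poly_Mapping.lookup w a"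
  "Poly_Mapping.lookup (inl_map w) (Inr c) = 0"
  unfolding inl_map_def
  by (rule lookup_injection, simp) (simp add: lookup_free_hom lookup_basis_vec)

lemma lookup_inr_map [simp]:
  "Poly_Mapping.lookup (inr_map w) (Inr c) = Poly_Mapping.lookup w c"
  "Poly_Mapping.lookup (inr_map w) (Inl a) = 0"
  unfolding inr_map_def
  by (rule lookup_injection, simp) (simp add: lookup_free_hom lookup_basis_vec)

lemma sum_module_eq_iff: "inl_map x + inr_map y = inl_map x' + inr_map y' \<longleftrightarrow> x = x' \<and> y = y'"
proof
  assume eq: "inl_map x + inr_map y = inl_map x' + inr_map y'"
  have "Poly_Mapping.lookup x a = Poly_Mapping.lookup x' a" for a
    using arg_cong[OF eq, of "\<lambda>w. Poly_Mapping.lookup w (Inl a)"] by (simp add: lookup_add)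
  moreover have "Poly_Mapping.lookup y c = Poly_Mapping.lookup y' c" for c
    using arg_cong[OF eq, of "\<lambda>w. Poly_Mapping.lookup w (Inr c)"] by (simp add: lookup_add)
  ultimately show "x = x' \<and> y = y'" by (simp add: poly_mapping_eqI)
qed simp

lemma sum_module_eq_0_iff: "inl_map x + inr_map y = 0 \<longleftrightarrow> x = 0 \<and> y = 0"
  using sum_module_eq_iff[of x y 0 0] by (simp add: inl_map_def inr_map_def)

lemma free_on_sum:
  "w \<in> free_on (Inl ` A \<union> Inr ` C) \<longleftrightarrow>
    (\<exists>x\<in>free_on A. \<exists>y\<in>free_on C. w = inl_map x + inr_map y)"
proof
  assume w: "w \<in> free_on (Inl ` A \<union> Inr ` C)"
  have "w = inl_map (Poly_Mapping.map_key Inl w) + inr_map (Poly_Mapping.map_key Inr w)"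
  proof (rule poly_mapping_eqI)
    fix x
    show "Poly_Mapping.lookup w x = Poly_Mapping.lookup
        (inl_map (Poly_Mapping.map_key Inl w) + inr_map (Poly_Mapping.map_key Inr w)) x"
      by (cases x) (simp_all add: lookup_add map_key.rep_eq)
  qed
  moreover have "Poly_Mapping.map_key Inl w \<in> free_on A" "Poly_Mapping.map_key Inr w \<in> free_on C"
    using w by (auto simp: free_on_iff map_key.rep_eq)
  ultimately show "\<exists>x\<in>free_on A. \<exists>y\<in>free_on C. w = inl_map x + inr_map y" by blast
next
  assume "\<exists>x\<in>free_on A. \<exists>y\<in>free_on C. w = inl_map x + inr_map y"
  then obtain x y where xy: "x \<in> free_on A" "y \<in> free_on C" "w = inl_map x + inr_map y" by blast
  show "w \<in> free_on (Inl ` A \<union> Inr ` C)"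
    unfolding free_on_iff
  proof (intro allI impI)
    fix z assume "z \<notin> Inl ` A \<union> Inr ` C"
    then show "Poly_Mapping.lookup w z = 0"
      using free_on_lookup[OF xy(1)] free_on_lookup[OF xy(2)] xy(3)
      by (cases z) (auto simp: lookup_add image_iff)
  qed
qed

lemma image_free_on_sum:
  assumes "\<And>x y. x \<in> free_on A \<Longrightarrow> y \<in> free_on C \<Longrightarrow> f (inl_map x + inr_map y) = g x y"
  shows "f ` free_on (Inl ` A \<union> Inr ` C) = {g x y | x y. x \<in> free_on A \<and> y \<in> free_on C}"
proof (intro equalityI subsetI, goal_cases)
  case (1 z)
  then obtain w where w: "z = f w" "w \<in> free_on (Inl ` A \<union> Inr ` C)" by blast
  then obtain x y where "x \<in> free_on A" "y \<in> free_on C" "w = inl_map x + inr_map y"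
    unfolding free_on_sum by blast
  with w(1) assms show ?case by blast
next
  case (2 z)
  then obtain x y where xy: "x \<in> free_on A" "y \<in> free_on C" "z = g x y" by blast
  then have "inl_map x + inr_map y \<in> free_on (Inl ` A \<union> Inr ` C)"
    unfolding free_on_sum by blast
  with xy assms show ?case by (metis image_eqI)
qed

lemma (in module) free_hom_sum_module:
  "free_hom scale \<phi> (inl_map x + inr_map y) =
    free_hom scale (\<lambda>a. \<phi> (Inl a)) x + free_hom scale (\<lambda>c. \<phi> (Inr c)) y"
  by (simp add: free_hom_add inl_map_def inr_map_def free_hom_comp)

lemma fcomp_sum_module:
  "fcomp (case_sum dgA dgC) n (inl_map x + inr_map y) = inl_map (fcomp dgA n x) + inr_map (fcomp dgC n y)"
proof (rule poly_mapping_eqI)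
  fix z
  show "Poly_Mapping.lookup (fcomp (case_sum dgA dgC) n (inl_map x + inr_map y)) z =
      Poly_Mapping.lookup (inl_map (fcomp dgA n x) + inr_map (fcomp dgC n y)) z"
    by (cases z) (simp_all add: lookup_fcomp lookup_add)
qed

lemma fcomp_shift:
  assumes "fcomp dg n w = w"
  shows "fcomp (\<lambda>b. dg b + e) (n + e) w = w"
proof (rule double_poly_mapping_eqI)
  fix b t
  show "Poly_Mapping.lookup (Poly_Mapping.lookup (fcomp (\<lambda>b. dg b + e) (n + e) w) b) t =
      Poly_Mapping.lookup (Poly_Mapping.lookup w b) t"
    using lookup_lookup_fcomp[of dg n w b t] assms by (simp add: lookup_lookup_fcomp)
qed

lemma free_hom_times: "free_hom (*) (\<lambda>a. \<phi> a * m) w = free_hom (*) \<phi> w * (m :: 'r::comm_ring_1)"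
  by (simp add: free_hom_def sum_distrib_right mult.assoc)

text \<open>
  The exact sequence \<open>0 \<rightarrow> R/(K : m)(-e) \<rightarrow> R/K \<rightarrow> R/(K + (m)) \<rightarrow> 0\<close> given by multiplication by
  \<open>m\<close>, with resolutions \<open>A\<close> and \<open>C\<close> of its outer terms.
\<close>

locale multiplication_sequence =
  A: graded_resolution Q BA dgA \<epsilon>A dA + C: graded_resolution L BC dgC \<epsilon>C dC
  for Q :: "('v::finite, 'k::field) mpoly set" and BA :: "nat \<Rightarrow> 'a set" and dgA \<epsilon>A dA
    and L :: "('v::finite, 'k::field) mpoly set" and BC :: "nat \<Rightarrow> 'c set" and dgC \<epsilon>C dC +
  fixes K :: "('v, 'k) mpoly set" and m :: "('v, 'k) mpoly" and e :: nat
  assumes K: "homogeneous_ideal K" and m: "hcomp e m = m"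
    and Q: "Q = ideal_colon K m" and L: "L = ideal_sum K (ideal_gen {m})"
begin

lemma ideal_K: "module.subspace (*) K"
  using K by (simp add: homogeneous_ideal_def)

lemmas K_add = module.subspace_add[OF ring_module ideal_K]
lemmas K_diff = module.subspace_diff[OF ring_module ideal_K]

lemma Q_iff: "q \<in> Q \<longleftrightarrow> q * m \<in> K"
  by (simp add: Q ideal_colon_def)

lemma L_iff: "p \<in> L \<longleftrightarrow> (\<exists>q. p - q * m \<in> K)"
proof
  assume "p \<in> L"
  then obtain a q where "p = a + q * m" "a \<in> K"
    unfolding L ideal_sum_def ideal_gen_def module.span_singleton[OF ring_module] by blast
  then show "\<exists>q. p - q * m \<in> K" by (intro exI[of _ q]) simp
next
  assume "\<exists>q. p - q * m \<in> K"
  then obtain q where q: "p - q * m \<in> K" by blast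
  have "p = (p - q * m) + q * m" by simp
  then show "p \<in> L"
    unfolding L ideal_sum_def ideal_gen_def module.span_singleton[OF ring_module] using q by blast
qed

abbreviation shift :: "'a \<Rightarrow> nat" where "shift \<equiv> \<lambda>a. dgA a + e"

lemma shifted_aug_homogeneous:
  assumes "a \<in> BA 0"
  shows "hcomp (shift a) (\<epsilon>A a * m) = \<epsilon>A a * m"
  using homogeneous_mult[of "dgA a" "\<epsilon>A a" e m] A.aug_homogeneous[OF assms] m
  by (simp add: homogeneous_iff)

lemma shifted_diff_homogeneous:
  "a \<in> BA (Suc i) \<Longrightarrow> fcomp shift (shift a) (dA (Suc i) a) = dA (Suc i) a"
  by (rule fcomp_shift[OF A.diff_homogeneous])

text \<open>
  The differential of the combined resolution is that of \<open>A \<oplus> C\<close> plus a homogeneous map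
  \<open>\<theta> i\<close> from step \<open>i + 1\<close> of \<open>C\<close> to step \<open>i\<close> of \<open>A\<close>. The conditions on \<open>\<theta>\<close> say that consecutive
  differentials compose to zero, where composites into \<open>R\<close> are taken modulo \<open>K\<close>.
\<close>

definition connecting :: "(nat \<Rightarrow> 'c \<Rightarrow> ('a \<Rightarrow>\<^sub>0 ('v, 'k) mpoly)) \<Rightarrow> bool" where
  "connecting \<theta> \<longleftrightarrow>
    (\<forall>i. \<forall>c\<in>BC (Suc i). \<theta> i c \<in> free_on (BA i) \<and> fcomp shift (dgC c) (\<theta> i c) = \<theta> i c) \<and>
    (\<forall>c\<in>BC (Suc 0). free_hom (*) \<epsilon>A (\<theta> 0 c) * m + free_hom (*) \<epsilon>C (dC (Suc 0) c) \<in> K) \<and>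
    (\<forall>i. \<forall>c\<in>BC (Suc (Suc i)).
      free_hom fscale (dA (Suc i)) (\<theta> (Suc i) c) = - free_hom fscale (\<theta> i) (dC (Suc (Suc i)) c))"

lemma connecting_aug:
  assumes "\<And>c. c \<in> BC (Suc 0) \<Longrightarrow> free_hom (*) \<epsilon>A (\<theta> c) * m + free_hom (*) \<epsilon>C (dC (Suc 0) c) \<in> K"
    and "w \<in> free_on (BC (Suc 0))"
  shows "free_hom (*) \<epsilon>A (free_hom fscale \<theta> w) * m
    + free_hom (*) \<epsilon>C (free_hom fscale (dC (Suc 0)) w) \<in> K"
proof -
  have "free_hom (*) (\<lambda>c. free_hom (*) \<epsilon>A (\<theta> c) * m + free_hom (*) \<epsilon>C (dC (Suc 0) c)) w \<in> K"
    by (rule module.free_hom_mem[OF ring_module assms(2) ideal_K assms(1)])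
  then show ?thesis
    by (simp add: module.free_hom_fun_add[OF ring_module] free_hom_times module.free_hom_comp[OF ring_module])
qed

text \<open>
  The values of \<open>\<theta> 0\<close> come from \<open>\<epsilon>C (dC c) \<in> K + (m)\<close>: the multiple of \<open>m\<close> has to be compensated.
  In later steps the value to be lifted is a cycle of \<open>A\<close> because \<open>\<theta>\<close> anticommutes with the
  differentials in the step before.
\<close>

lemma connecting_exists: "\<exists>\<theta>. connecting \<theta>"
proof -
  define P where "P i \<theta> \<longleftrightarrow>
      (\<forall>c\<in>BC (Suc i). \<theta> c \<in> free_on (BA i) \<and> fcomp shift (dgC c) (\<theta> c) = \<theta> c) \<and>
      (\<forall>w\<in>C.cycles (Suc i). free_hom fscale \<theta> w \<in> A.cycles i) \<and>
      (i = 0 \<longrightarrow> (\<forall>c\<in>BC (Suc 0). free_hom (*) \<epsilon>A (\<theta> c) * m + free_hom (*) \<epsilon>C (dC (Suc 0) c) \<in> K))"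
    for i and \<theta> :: "'c \<Rightarrow> ('a \<Rightarrow>\<^sub>0 ('v, 'k) mpoly)"
  define S where "S i \<theta> \<theta>' \<longleftrightarrow> (\<forall>c\<in>BC (Suc (Suc i)).
      free_hom fscale (dA (Suc i)) (\<theta>' c) = - free_hom fscale \<theta> (dC (Suc (Suc i)) c))"
    for i and \<theta> \<theta>' :: "'c \<Rightarrow> ('a \<Rightarrow>\<^sub>0 ('v, 'k) mpoly)"
  have "\<exists>\<theta>. \<forall>i. P i (\<theta> i) \<and> S i (\<theta> i) (\<theta> (Suc i))"
  proof (rule dependent_nat_choice)
    have "\<exists>w. w \<in> free_on (BA 0) \<and> fcomp shift (dgC c) w = w \<and>
        free_hom (*) \<epsilon>A w * m + free_hom (*) \<epsilon>C (dC (Suc 0) c) \<in> K" if c: "c \<in> BC (Suc 0)" for c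
    proof -
      have "free_hom (*) \<epsilon>C (dC (Suc 0) c) \<in> L"
        using C.diff_cycles[OF c] by (simp add: C.cycles_0)
      then obtain q where q: "free_hom (*) \<epsilon>C (dC (Suc 0) c) - q * m \<in> K"
        by (auto simp: L_iff)
      obtain w where w: "w \<in> free_on (BA 0)" "- q - free_hom (*) \<epsilon>A w \<in> Q"
        using A.aug_surj by blast
      let ?w = "fcomp shift (dgC c) w"
      have "free_hom (*) \<epsilon>C (dC (Suc 0) c) - q * m - (- q - free_hom (*) \<epsilon>A w) * m \<in> K"
        using K_diff[OF q] w(2) by (simp add: Q_iff)
      then have "free_hom (*) (\<lambda>a. \<epsilon>A a * m) w + free_hom (*) \<epsilon>C (dC (Suc 0) c) \<in> K"
        unfolding free_hom_times by (simp add: algebra_simps)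
      then have "hcomp (dgC c) (free_hom (*) (\<lambda>a. \<epsilon>A a * m) w + free_hom (*) \<epsilon>C (dC (Suc 0) c)) \<in> K"
        using K by (simp add: homogeneous_ideal_def)
      also have "hcomp (dgC c) (free_hom (*) (\<lambda>a. \<epsilon>A a * m) w + free_hom (*) \<epsilon>C (dC (Suc 0) c))
          = free_hom (*) (\<lambda>a. \<epsilon>A a * m) ?w + free_hom (*) \<epsilon>C (fcomp dgC (dgC c) (dC (Suc 0) c))"
        using graded_module.hc_free_hom[OF poly_graded, of "BA 0" shift "\<lambda>a. \<epsilon>A a * m" w "dgC c"]
          graded_module.hc_free_hom[OF poly_graded, of "BC 0" dgC \<epsilon>C _ "dgC c", OF _ C.diff_mem[OF c]]
          shifted_aug_homogeneous w(1) C.aug_homogeneous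
        by (simp add: hcomp_add)
      finally have "free_hom (*) \<epsilon>A ?w * m + free_hom (*) \<epsilon>C (dC (Suc 0) c) \<in> K"
        by (simp add: free_hom_times C.diff_homogeneous[OF c])
      then show ?thesis
        using w(1) by (intro exI[of _ ?w]) (simp add: fcomp_free_on free_graded.hc_hc)
    qed
    then obtain \<theta> where \<theta>: "\<And>c. c \<in> BC (Suc 0) \<Longrightarrow> \<theta> c \<in> free_on (BA 0)"
        "\<And>c. c \<in> BC (Suc 0) \<Longrightarrow> fcomp shift (dgC c) (\<theta> c) = \<theta> c"
        "\<And>c. c \<in> BC (Suc 0) \<Longrightarrow> free_hom (*) \<epsilon>A (\<theta> c) * m + free_hom (*) \<epsilon>C (dC (Suc 0) c) \<in> K"
      by metis
    have "free_hom fscale \<theta> w \<in> A.cycles 0" if "w \<in> C.cycles (Suc 0)" for w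
    proof -
      have w: "w \<in> free_on (BC (Suc 0))" "free_hom fscale (dC (Suc 0)) w = 0"
        using that by (auto simp: C.cycles_Suc)
      have "free_hom (*) \<epsilon>A (free_hom fscale \<theta> w) * m \<in> K"
        using connecting_aug[of \<theta>, OF \<theta>(3) w(1)]
        by (simp add: w(2) module.free_hom_zero[OF ring_module])
      moreover have "free_hom fscale \<theta> w \<in> free_on (BA 0)"
        by (rule fmod.free_hom_mem[OF w(1) subspace_free_on \<theta>(1)])
      ultimately show ?thesis by (simp add: A.cycles_0 Q_iff)
    qed
    with \<theta> show "\<exists>\<theta>. P 0 \<theta>" unfolding P_def by (intro exI[of _ \<theta>]) blast
  next
    fix \<theta> i assume P: "P i \<theta>"
    have "\<exists>w. w \<in> free_on (BA (Suc i)) \<and> fcomp shift (dgC c) w = w \<and>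
        free_hom fscale (dA (Suc i)) w = - free_hom fscale \<theta> (dC (Suc (Suc i)) c)"
      if c: "c \<in> BC (Suc (Suc i))" for c
    proof -
      have hom: "fcomp shift (dgC c) (- free_hom fscale \<theta> (dC (Suc (Suc i)) c))
          = - free_hom fscale \<theta> (dC (Suc (Suc i)) c)"
        unfolding free_graded.hc_minus using P
          free_hom_homogeneous[of "BC (Suc i)" shift dgC \<theta>, OF _ C.diff_mem[OF c] C.diff_homogeneous[OF c]]
        by (simp add: P_def)
      have "free_hom fscale \<theta> (dC (Suc (Suc i)) c) \<in> A.cycles i"
        using P C.diff_cycles[OF c] by (simp add: P_def)
      then have img: "- free_hom fscale \<theta> (dC (Suc (Suc i)) c)
          \<in> free_hom fscale (dA (Suc i)) ` free_on (BA (Suc i))"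
        using fmod.subspace_neg[OF A.subspace_cycles] by (simp add: A.cycles_def)
      show ?thesis
        by (rule free_graded.homogeneous_preimage[OF shifted_diff_homogeneous hom img]) blast+
    qed
    then obtain \<theta>' where \<theta>': "\<And>c. c \<in> BC (Suc (Suc i)) \<Longrightarrow> \<theta>' c \<in> free_on (BA (Suc i))"
        "\<And>c. c \<in> BC (Suc (Suc i)) \<Longrightarrow> fcomp shift (dgC c) (\<theta>' c) = \<theta>' c"
        "\<And>c. c \<in> BC (Suc (Suc i)) \<Longrightarrow>
          free_hom fscale (dA (Suc i)) (\<theta>' c) = - free_hom fscale \<theta> (dC (Suc (Suc i)) c)"
      by metis
    have "free_hom fscale \<theta>' w \<in> A.cycles (Suc i)" if "w \<in> C.cycles (Suc (Suc i))" for w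
    proof -
      have w: "w \<in> free_on (BC (Suc (Suc i)))" "free_hom fscale (dC (Suc (Suc i))) w = 0"
        using that by (auto simp: C.cycles_Suc)
      have "free_hom fscale (dA (Suc i)) (free_hom fscale \<theta>' w) =
          free_hom fscale (\<lambda>c. 0 - free_hom fscale \<theta> (dC (Suc (Suc i)) c)) w"
        unfolding fmod.free_hom_comp by (rule fmod.free_hom_cong[OF w(1)]) (simp add: \<theta>'(3))
      also have "\<dots> = 0"
        unfolding fmod.free_hom_fun_diff fmod.free_hom_comp[symmetric] w(2)
        by (simp add: free_hom_def)
      finally show ?thesis
        using fmod.free_hom_mem[OF w(1) subspace_free_on \<theta>'(1)] by (simp add: A.cycles_Suc)
    qed
    with \<theta>' show "\<exists>\<theta>'. P (Suc i) \<theta>' \<and> S i \<theta> \<theta>'"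
      unfolding P_def S_def by (intro exI[of _ \<theta>']) blast
  qed
  then obtain \<theta> where "\<And>i. P i (\<theta> i)" "\<And>i. S i (\<theta> i) (\<theta> (Suc i))" by blast
  then show ?thesis unfolding P_def S_def connecting_def by (intro exI[of _ \<theta>]) blast
qed

text \<open>
  Exactness is a diagram chase. A cycle \<open>(x, y)\<close> has a cycle \<open>y\<close> of \<open>C\<close> as second component, so
  \<open>y\<close> is a boundary, say of \<open>y'\<close>; subtracting the boundary of \<open>(0, y')\<close> leaves a cycle of \<open>A\<close>. The
  augmentation of \<open>C\<close> takes values in \<open>R\<close>, so these serve as lifts to \<open>R/K\<close> as they are.
\<close>

theorem horseshoe:
  "\<exists>\<epsilon> d. graded_resolution K (\<lambda>i. Inl ` BA i \<union> Inr ` BC i) (case_sum shift dgC) \<epsilon> d"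
proof -
  obtain \<theta> where "connecting \<theta>" using connecting_exists by blast
  then have \<theta>: "\<And>i c. c \<in> BC (Suc i) \<Longrightarrow> \<theta> i c \<in> free_on (BA i)"
      "\<And>i c. c \<in> BC (Suc i) \<Longrightarrow> fcomp shift (dgC c) (\<theta> i c) = \<theta> i c"
      "\<And>c. c \<in> BC (Suc 0) \<Longrightarrow> free_hom (*) \<epsilon>A (\<theta> 0 c) * m + free_hom (*) \<epsilon>C (dC (Suc 0) c) \<in> K"
      "\<And>i c. c \<in> BC (Suc (Suc i)) \<Longrightarrow>
        free_hom fscale (dA (Suc i)) (\<theta> (Suc i) c) = - free_hom fscale (\<theta> i) (dC (Suc (Suc i)) c)"
    unfolding connecting_def by blast+
  have \<theta>mem: "free_hom fscale (\<theta> i) y \<in> free_on (BA i)" if "y \<in> free_on (BC (Suc i))" for i y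
    by (rule fmod.free_hom_mem[OF that subspace_free_on \<theta>(1)])
  have anti: "free_hom fscale (dA (Suc i)) (free_hom fscale (\<theta> (Suc i)) y) =
      - free_hom fscale (\<theta> i) (free_hom fscale (dC (Suc (Suc i))) y)"
    if "y \<in> free_on (BC (Suc (Suc i)))" for i y
  proof -
    have "free_hom fscale (dA (Suc i)) (free_hom fscale (\<theta> (Suc i)) y) =
        free_hom fscale (\<lambda>c. 0 - free_hom fscale (\<theta> i) (dC (Suc (Suc i)) c)) y"
      unfolding fmod.free_hom_comp by (rule fmod.free_hom_cong[OF that]) (simp add: \<theta>(4))
    then show ?thesis
      unfolding fmod.free_hom_fun_diff by (simp add: free_hom_def[of _ "\<lambda>_. 0"] fmod.free_hom_comp)
  qed
  let ?B = "\<lambda>i. Inl ` BA i \<union> Inr ` BC i"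
  define \<epsilon> where "\<epsilon> = case_sum (\<lambda>a. \<epsilon>A a * m) \<epsilon>C"
  define d where "d i = case_sum (\<lambda>a. inl_map (dA i a)) (\<lambda>c. inl_map (\<theta> (i - 1) c) + inr_map (dC i c))" for i
  have aug: "free_hom (*) \<epsilon> (inl_map x + inr_map y) = free_hom (*) \<epsilon>A x * m + free_hom (*) \<epsilon>C y" for x y
    by (simp add: module.free_hom_sum_module[OF ring_module] \<epsilon>_def free_hom_times)
  have diff: "free_hom fscale (d (Suc i)) (inl_map x + inr_map y) =
      inl_map (free_hom fscale (dA (Suc i)) x + free_hom fscale (\<theta> i) y)
      + inr_map (free_hom fscale (dC (Suc i)) y)" for i x y
    by (simp add: fmod.free_hom_sum_module d_def fmod.free_hom_fun_add inl_map_def inr_map_def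
        fmod.free_hom_add fmod.free_hom_comp add.assoc)
  have image: "free_hom fscale (d (Suc i)) ` free_on (?B (Suc i)) =
      {inl_map (free_hom fscale (dA (Suc i)) x + free_hom fscale (\<theta> i) y)
        + inr_map (free_hom fscale (dC (Suc i)) y) | x y. x \<in> free_on (BA (Suc i)) \<and> y \<in> free_on (BC (Suc i))}"
    for i by (rule image_free_on_sum) (rule diff)
  have "graded_resolution K ?B (case_sum shift dgC) \<epsilon> d"
  proof
    show "homogeneous_ideal K" by (rule K)
    show "hcomp (case_sum shift dgC b) (\<epsilon> b) = \<epsilon> b" if "b \<in> ?B 0" for b
      using that by (auto simp: \<epsilon>_def shifted_aug_homogeneous C.aug_homogeneous)
    show "d (Suc i) b \<in> free_on (?B i)" if "b \<in> ?B (Suc i)" for b i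
    proof -
      have mem: "inl_map x + inr_map y \<in> free_on (?B i)" if "x \<in> free_on (BA i)" "y \<in> free_on (BC i)" for x y
        using that unfolding free_on_sum by blast
      have 0: "0 \<in> free_on (BC i)" "inr_map 0 = 0"
        by (simp_all add: fmod.subspace_0[OF subspace_free_on] inr_map_def)
      from that show ?thesis
        using mem[OF A.diff_mem 0(1)] mem[OF \<theta>(1) C.diff_mem] by (auto simp: d_def 0(2))
    qed
    show "fcomp (case_sum shift dgC) (case_sum shift dgC b) (d (Suc i) b) = d (Suc i) b"
      if "b \<in> ?B (Suc i)" for b i
    proof -
      have 0: "inr_map 0 = 0" by (simp add: inr_map_def)
      have "fcomp (case_sum shift dgC) (shift a) (inl_map (dA (Suc i) a)) = inl_map (dA (Suc i) a)"
        if "a \<in> BA (Suc i)" for a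
        using fcomp_sum_module[of shift dgC "shift a" "dA (Suc i) a" 0] shifted_diff_homogeneous[OF that]
        by (simp add: 0)
      with that show ?thesis
        by (auto simp: d_def fcomp_sum_module C.diff_homogeneous \<theta>(2))
    qed
    show "\<exists>w\<in>free_on (?B 0). p - free_hom (*) \<epsilon> w \<in> K" for p
    proof -
      obtain y where y: "y \<in> free_on (BC 0)" "p - free_hom (*) \<epsilon>C y \<in> L" using C.aug_surj by blast
      then obtain q where q: "p - free_hom (*) \<epsilon>C y - q * m \<in> K" by (auto simp: L_iff)
      obtain x where x: "x \<in> free_on (BA 0)" "q - free_hom (*) \<epsilon>A x \<in> Q" using A.aug_surj by blast
      have "(p - free_hom (*) \<epsilon>C y - q * m) + (q - free_hom (*) \<epsilon>A x) * m \<in> K"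
        using K_add[OF q] x(2) by (simp add: Q_iff)
      then have "p - free_hom (*) \<epsilon> (inl_map x + inr_map y) \<in> K"
        by (simp add: aug algebra_simps)
      then show ?thesis using x(1) y(1) free_on_sum[of _ "BA 0" "BC 0"] by blast
    qed
    show "free_hom fscale (d (Suc 0)) ` free_on (?B (Suc 0)) = {w \<in> free_on (?B 0). free_hom (*) \<epsilon> w \<in> K}"
      unfolding image
    proof (intro equalityI subsetI, goal_cases)
      case (1 w)
      then obtain x y where xy: "x \<in> free_on (BA (Suc 0))" "y \<in> free_on (BC (Suc 0))"
        "w = inl_map (free_hom fscale (dA (Suc 0)) x + free_hom fscale (\<theta> 0) y)
          + inr_map (free_hom fscale (dC (Suc 0)) y)" by blast
      have dx: "free_hom fscale (dA (Suc 0)) x \<in> A.cycles 0" and dy: "free_hom fscale (dC (Suc 0)) y \<in> C.cycles 0"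
        using xy by (auto simp: A.cycles_def C.cycles_def)
      have "free_hom (*) \<epsilon>A (free_hom fscale (dA (Suc 0)) x) * m +
          (free_hom (*) \<epsilon>A (free_hom fscale (\<theta> 0) y) * m
            + free_hom (*) \<epsilon>C (free_hom fscale (dC (Suc 0)) y)) \<in> K"
        using dx connecting_aug[of "\<theta> 0", OF \<theta>(3) xy(2)] by - (rule K_add, auto simp: A.cycles_0 Q_iff)
      then have "free_hom (*) \<epsilon> w \<in> K"
        unfolding xy(3) aug
        unfolding module.free_hom_add[OF ring_module] by (simp add: algebra_simps)
      moreover have "w \<in> free_on (?B 0)"
        unfolding free_on_sum xy(3)
        using dx dy \<theta>mem[OF xy(2)] by (auto simp: A.cycles_0 C.cycles_0 fmod.subspace_add[OF subspace_free_on])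
      ultimately show ?case by blast
    next
      case (2 w)
      then obtain x y where xy: "x \<in> free_on (BA 0)" "y \<in> free_on (BC 0)" "w = inl_map x + inr_map y"
        by (auto simp: free_on_sum)
      have K1: "free_hom (*) \<epsilon>A x * m + free_hom (*) \<epsilon>C y \<in> K" using 2 by (simp add: xy(3) aug)
      then have "free_hom (*) \<epsilon>C y - (- free_hom (*) \<epsilon>A x) * m \<in> K" by (simp add: algebra_simps)
      then have "y \<in> C.cycles 0" using xy(2) unfolding C.cycles_0 L_iff by blast
      then obtain y' where y': "y' \<in> free_on (BC (Suc 0))" "y = free_hom fscale (dC (Suc 0)) y'"
        by (auto simp: C.cycles_def)
      have "free_hom (*) \<epsilon>A (x - free_hom fscale (\<theta> 0) y') * m \<in> K"
        using K_diff[OF K1 connecting_aug[of "\<theta> 0", OF \<theta>(3) y'(1)]]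
        by (simp add: y'(2) module.free_hom_diff[OF ring_module] algebra_simps)
      then have "x - free_hom fscale (\<theta> 0) y' \<in> A.cycles 0"
        using xy(1) \<theta>mem[OF y'(1)] by (simp add: A.cycles_0 Q_iff fmod.subspace_diff[OF subspace_free_on])
      then obtain x' where "x' \<in> free_on (BA (Suc 0))"
          "x - free_hom fscale (\<theta> 0) y' = free_hom fscale (dA (Suc 0)) x'"
        by (auto simp: A.cycles_def)
      then have "x' \<in> free_on (BA (Suc 0))"
          "w = inl_map (free_hom fscale (dA (Suc 0)) x' + free_hom fscale (\<theta> 0) y')
            + inr_map (free_hom fscale (dC (Suc 0)) y')"
        by (simp_all add: xy(3) y'(2) algebra_simps)
      then show ?case using y'(1) by blast
    qed
    show "free_hom fscale (d (Suc (Suc i))) ` free_on (?B (Suc (Suc i))) =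
        {w \<in> free_on (?B (Suc i)). free_hom fscale (d (Suc i)) w = 0}" for i
      unfolding image
    proof (intro equalityI subsetI, goal_cases)
      case (1 w)
      then obtain x y where xy: "x \<in> free_on (BA (Suc (Suc i)))" "y \<in> free_on (BC (Suc (Suc i)))"
        "w = inl_map (free_hom fscale (dA (Suc (Suc i))) x + free_hom fscale (\<theta> (Suc i)) y)
          + inr_map (free_hom fscale (dC (Suc (Suc i))) y)" by blast
      have dx: "free_hom fscale (dA (Suc (Suc i))) x \<in> A.cycles (Suc i)"
        and dy: "free_hom fscale (dC (Suc (Suc i))) y \<in> C.cycles (Suc i)"
        using xy by (auto simp: A.cycles_def C.cycles_def)
      have "free_hom fscale (d (Suc i)) w = 0"
        unfolding xy(3) diff sum_module_eq_0_iff
        using dx dy by (simp add: A.cycles_Suc C.cycles_Suc fmod.free_hom_add anti[OF xy(2)])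
      moreover have "w \<in> free_on (?B (Suc i))"
        unfolding free_on_sum xy(3)
        using dx dy \<theta>mem[OF xy(2)] by (auto simp: A.cycles_Suc C.cycles_Suc fmod.subspace_add[OF subspace_free_on])
      ultimately show ?case by blast
    next
      case (2 w)
      then obtain x y where xy: "x \<in> free_on (BA (Suc i))" "y \<in> free_on (BC (Suc i))" "w = inl_map x + inr_map y"
        by (auto simp: free_on_sum)
      have 0: "free_hom fscale (dA (Suc i)) x + free_hom fscale (\<theta> i) y = 0"
          "free_hom fscale (dC (Suc i)) y = 0"
        using 2 by (simp_all add: xy(3) diff sum_module_eq_0_iff)
      then have "y \<in> C.cycles (Suc i)" using xy(2) by (simp add: C.cycles_Suc)
      then obtain y' where y': "y' \<in> free_on (BC (Suc (Suc i)))" "y = free_hom fscale (dC (Suc (Suc i))) y'"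
        by (auto simp: C.cycles_def)
      have "free_hom fscale (dA (Suc i)) (x - free_hom fscale (\<theta> (Suc i)) y') = 0"
        using 0(1) by (simp add: fmod.free_hom_diff anti[OF y'(1)] y'(2))
      then have "x - free_hom fscale (\<theta> (Suc i)) y' \<in> A.cycles (Suc i)"
        using xy(1) \<theta>mem[OF y'(1)] by (simp add: A.cycles_Suc fmod.subspace_diff[OF subspace_free_on])
      then obtain x' where "x' \<in> free_on (BA (Suc (Suc i)))"
          "x - free_hom fscale (\<theta> (Suc i)) y' = free_hom fscale (dA (Suc (Suc i))) x'"
        by (auto simp: A.cycles_def)
      then have "x' \<in> free_on (BA (Suc (Suc i)))"
          "w = inl_map (free_hom fscale (dA (Suc (Suc i))) x' + free_hom fscale (\<theta> (Suc i)) y')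
            + inr_map (free_hom fscale (dC (Suc (Suc i))) y')"
        by (simp_all add: xy(3) y'(2) algebra_simps)
      then show ?case using y'(1) by blast
    qed
  qed
  then show ?thesis by blast
qed

end


section \<open>Regularity along the multiplication sequence\<close>

text \<open>
  The ranks \<open>graded_betti I\<close> are chosen by means of \<open>SOME\<close>; since a minimal resolution exists, they
  are the ranks of one.
\<close>

lemma minimal_resolution_graded_betti:
  fixes I :: "('v::finite, 'k::field) mpoly set"
  assumes I: "homogeneous_ideal I"
  shows "\<exists>\<epsilon> d. minimal_resolution I (\<lambda>i. basis_index (graded_betti I i)) fst \<epsilon> d"
proof -
  have "\<exists>\<epsilon> d. minimal_graded_free_resolution I (graded_betti I) \<epsilon> d"
    unfolding graded_betti_def
    by (rule someI_ex[OF minimal_graded_free_resolution_exists[OF I]])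
  then obtain \<epsilon> d where min: "minimal_graded_free_resolution I (graded_betti I) \<epsilon> d" by blast
  then have res: "graded_free_resolution I (graded_betti I) \<epsilon> d"
    by (simp add: minimal_graded_free_resolution_def)
  note r = res[unfolded graded_free_resolution_def free_scale_eq_fscale free_homogeneous_iff
      homogeneous_iff free_module_eq]
  note aug = conjunct1[OF r] and diff = conjunct1[OF conjunct2[OF r]]
    and surj = conjunct1[OF conjunct2[OF conjunct2[OF r]]]
    and ex0 = conjunct1[OF conjunct2[OF conjunct2[OF conjunct2[OF r]]]]
    and ex = conjunct2[OF conjunct2[OF conjunct2[OF conjunct2[OF r]]]]
  have "minimal_resolution I (\<lambda>i. basis_index (graded_betti I i)) fst \<epsilon> d"
  proof
    show "homogeneous_ideal I" by (rule I)
    show "hcomp (fst b) (\<epsilon> b) = \<epsilon> b" if "b \<in> basis_index (graded_betti I 0)" for b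
      using aug that by blast
    show "d (Suc i) b \<in> free_on (basis_index (graded_betti I i))"
      "fcomp fst (fst b) (d (Suc i) b) = d (Suc i) b"
      if "b \<in> basis_index (graded_betti I (Suc i))" for i b
      using diff that by blast+
    show "\<exists>w\<in>free_on (basis_index (graded_betti I 0)). p - free_hom (*) \<epsilon> w \<in> I" for p
      using surj by blast
    show "free_hom fscale (d (Suc 0)) ` free_on (basis_index (graded_betti I (Suc 0))) =
        {w \<in> free_on (basis_index (graded_betti I 0)). free_hom (*) \<epsilon> w \<in> I}"
      using ex0 by (simp only: One_nat_def)
    show "free_hom fscale (d (Suc (Suc i))) ` free_on (basis_index (graded_betti I (Suc (Suc i)))) =
        {w \<in> free_on (basis_index (graded_betti I (Suc i))). free_hom fscale (d (Suc i)) w = 0}" for i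
      by (rule ex[THEN spec, THEN mp]) simp
    show "d (Suc i) b \<in> max_free" if "b \<in> basis_index (graded_betti I (Suc i))" for i b
      using min that unfolding minimal_graded_free_resolution_def max_free_iff by blast
  qed
  then show ?thesis by blast
qed

lemma graded_betti_nonzero_iff:
  "graded_betti I i j \<noteq> 0 \<longleftrightarrow> (\<exists>b\<in>basis_index (graded_betti I i). fst b = j)"
  unfolding basis_index_def by (auto intro!: exI[of _ 0])

lemma homogeneous_ideal_colon:
  assumes K: "homogeneous_ideal K" and m: "hcomp e m = m"
  shows "homogeneous_ideal (ideal_colon K m)"
proof -
  have sub: "module.subspace (*) K" using K by (simp add: homogeneous_ideal_def)
  have "module.subspace (*) (ideal_colon K m)"
    by (rule module.subspaceI[OF ring_module])
      (auto simp: ideal_colon_def distrib_right mult.assoc intro: module.subspace_0[OF ring_module sub]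
        module.subspace_add[OF ring_module sub] module.subspace_scale[OF ring_module sub])
  moreover have "hcomp n p \<in> ideal_colon K m" if "p \<in> ideal_colon K m" for p n
  proof -
    have "hcomp (n + e) (p * m) \<in> K" using that K by (simp add: ideal_colon_def homogeneous_ideal_def)
    then show ?thesis by (simp add: hcomp_homogeneous_mult[OF m] ideal_colon_def)
  qed
  ultimately show ?thesis by (simp add: homogeneous_ideal_def)
qed

lemma homogeneous_ideal_sum_principal:
  assumes K: "homogeneous_ideal K" and m: "hcomp e m = m"
  shows "homogeneous_ideal (ideal_sum K (ideal_gen {m}))"
proof -
  have sub: "module.subspace (*) K" using K by (simp add: homogeneous_ideal_def)
  have eq: "ideal_sum K (ideal_gen {m}) = {a + q * m | a q. a \<in> K}"
    unfolding ideal_sum_def ideal_gen_def module.span_singleton[OF ring_module] by blast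
  have "module.subspace (*) (ideal_sum K (ideal_gen {m}))"
  proof -
    have "module.span (*) K = K"
      by (simp add: module.span_eq_iff[OF ring_module] sub)
    then have "ideal_sum K (ideal_gen {m}) = module.span (*) (K \<union> {m})"
      unfolding ideal_sum_def ideal_gen_def module.span_Un[OF ring_module] by simp
    then show ?thesis by (simp add: module.subspace_span[OF ring_module])
  qed
  moreover have "hcomp n p \<in> ideal_sum K (ideal_gen {m})" if p: "p \<in> ideal_sum K (ideal_gen {m})" for p n
  proof -
    obtain a q where aq: "p = a + q * m" "a \<in> K" using p by (auto simp: eq)
    have "hcomp n p = hcomp n a + (if e \<le> n then hcomp (n - e) q else 0) * m"
      by (simp add: aq(1) hcomp_add hcomp_homogeneous_mult[OF m])
    moreover have "hcomp n a \<in> K" using aq(2) K by (simp add: homogeneous_ideal_def)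
    ultimately show ?thesis unfolding eq by blast
  qed
  ultimately show ?thesis by (simp add: homogeneous_ideal_def)
qed

text \<open>
  If \<open>\<beta>\<^sub>i\<^sub>,\<^sub>j(R/K)\<close> is not zero, then degree \<open>j\<close> occurs in step \<open>i\<close> of the combined resolution: either
  \<open>\<beta>\<^sub>i\<^sub>,\<^sub>j\<^sub>-\<^sub>e(R/(K : m))\<close> or \<open>\<beta>\<^sub>i\<^sub>,\<^sub>j(R/(K + (m)))\<close> is not zero.
\<close>

theorem reg_quot_le_colon_sum:
  fixes K :: "('v::finite, 'k::field) mpoly set"
  assumes K: "homogeneous_ideal K" and m: "hcomp e m = m"
  shows "reg_quot K \<le> max (ereal (real e) + reg_quot (ideal_colon K m))
    (reg_quot (ideal_sum K (ideal_gen {m})))"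
proof -
  let ?Q = "ideal_colon K m" and ?L = "ideal_sum K (ideal_gen {m})"
  obtain \<epsilon>K dK where F: "minimal_resolution K (\<lambda>i. basis_index (graded_betti K i)) fst \<epsilon>K dK"
    using minimal_resolution_graded_betti[OF K] by blast
  obtain \<epsilon>A dA where A: "minimal_resolution ?Q (\<lambda>i. basis_index (graded_betti ?Q i)) fst \<epsilon>A dA"
    using minimal_resolution_graded_betti[OF homogeneous_ideal_colon[OF K m]] by blast
  obtain \<epsilon>C dC where C: "minimal_resolution ?L (\<lambda>i. basis_index (graded_betti ?L i)) fst \<epsilon>C dC"
    using minimal_resolution_graded_betti[OF homogeneous_ideal_sum_principal[OF K m]] by blast
  interpret F: minimal_resolution K "\<lambda>i. basis_index (graded_betti K i)" fst \<epsilon>K dK by (rule F)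
  interpret multiplication_sequence ?Q "\<lambda>i. basis_index (graded_betti ?Q i)" fst \<epsilon>A dA
      ?L "\<lambda>i. basis_index (graded_betti ?L i)" fst \<epsilon>C dC K m e
    by (intro multiplication_sequence.intro multiplication_sequence_axioms.intro K m refl
        minimal_resolution.axioms(1)[OF A] minimal_resolution.axioms(1)[OF C])
  obtain \<epsilon> d where G: "graded_resolution K
      (\<lambda>i. Inl ` basis_index (graded_betti ?Q i) \<union> Inr ` basis_index (graded_betti ?L i))
      (case_sum (\<lambda>a. fst a + e) fst) \<epsilon> d"
    using horseshoe by blast
  have "ereal (real j - real i) \<le> max (ereal (real e) + reg_quot ?Q) (reg_quot ?L)"
    if nz: "graded_betti K i j \<noteq> 0" for i j
  proof -
    obtain b where "b \<in> basis_index (graded_betti K i)" "fst b = j"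
      using nz unfolding graded_betti_nonzero_iff by blast
    then obtain c where c: "c \<in> Inl ` basis_index (graded_betti ?Q i) \<union> Inr ` basis_index (graded_betti ?L i)"
        "case_sum (\<lambda>a. fst a + e) fst c = j"
      using F.degrees_of_minimal_resolution[OF G] by blast
    then consider (l) j' where "graded_betti ?Q i j' \<noteq> 0" "j = j' + e" | (r) "graded_betti ?L i j \<noteq> 0"
      unfolding graded_betti_nonzero_iff by (elim UnE imageE) auto
    then show ?thesis
    proof cases
      case l
      have "ereal (real j' - real i) \<le> reg_quot ?Q"
        unfolding reg_quot_def using l(1) by (intro Sup_upper) blast
      then have "ereal (real e) + ereal (real j' - real i) \<le> ereal (real e) + reg_quot ?Q"
        by (rule add_left_mono)
      also have "ereal (real e) + ereal (real j' - real i) = ereal (real j - real i)"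
        by (simp add: l(2))
      finally show ?thesis by (simp add: le_max_iff_disj)
    next
      case r
      then have "ereal (real j - real i) \<le> reg_quot ?L"
        unfolding reg_quot_def by (intro Sup_upper) blast
      then show ?thesis by (simp add: le_max_iff_disj)
    qed
  qed
  then show ?thesis
    unfolding reg_quot_def[of K] by (intro Sup_least) blast
qed


section \<open>Operations on monomial ideals\<close>

lemma up_closure_iff:
  "t \<in> up_closure S \<longleftrightarrow> (\<exists>s\<in>S. \<forall>v. Poly_Mapping.lookup s v \<le> Poly_Mapping.lookup t v)"
proof
  assume "\<exists>s\<in>S. \<forall>v. Poly_Mapping.lookup s v \<le> Poly_Mapping.lookup t v"
  then obtain s where s: "s \<in> S" "\<And>v. Poly_Mapping.lookup s v \<le> Poly_Mapping.lookup t v" by blast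
  have "t = s + (t - s)"
    using s(2) by (intro poly_mapping_eqI) (simp add: lookup_add lookup_minus)
  with s(1) show "t \<in> up_closure S" unfolding up_closure_def by blast
next
  assume "t \<in> up_closure S"
  then obtain s u where "t = s + u" "s \<in> S" by (auto simp: up_closure_def)
  then show "\<exists>s\<in>S. \<forall>v. Poly_Mapping.lookup s v \<le> Poly_Mapping.lookup t v"
    by (intro bexI[of _ s]) (simp_all add: lookup_add)
qed

lemma up_closure_empty [simp]: "up_closure {} = {}"
  by (simp add: up_closure_def)

lemma up_closure_zero [simp]: "up_closure {0} = UNIV"
  by (auto simp: up_closure_iff)

lemma up_closure_Un: "up_closure (S \<union> T) = up_closure S \<union> up_closure T"
  unfolding up_closure_def by blast

lemma mono_ideal_UNIV [simp]: "mono_ideal UNIV = UNIV"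
  by (simp add: mono_ideal_def)

lemma ideal_sum_mono: "ideal_sum (mono_ideal U) (mono_ideal V) = mono_ideal (U \<union> V)"
proof
  show "ideal_sum (mono_ideal U) (mono_ideal V) \<subseteq> mono_ideal (U \<union> V)"
    unfolding ideal_sum_def mono_ideal_def using keys_add by fastforce
  show "mono_ideal (U \<union> V) \<subseteq> ideal_sum (mono_ideal U) (mono_ideal V :: ('a, 'b) mpoly set)"
  proof
    fix p :: "('a, 'b) mpoly" assume p: "p \<in> mono_ideal (U \<union> V)"
    let ?S = "\<lambda>T. \<Sum>t\<in>T. Poly_Mapping.single t (Poly_Mapping.lookup p t)"
    let ?K = "Poly_Mapping.keys p"
    have "p = ?S (?K \<inter> U) + ?S (?K - U)"
      by (subst sum_single) (rule sum.Int_Diff, simp)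
    moreover have "?S (?K \<inter> U) \<in> mono_ideal U" "?S (?K - U) \<in> mono_ideal V"
      using p by (auto simp: mono_ideal_def dest!: keys_sum[THEN subsetD] split: if_splits)
    ultimately show "p \<in> ideal_sum (mono_ideal U) (mono_ideal V)"
      unfolding ideal_sum_def by blast
  qed
qed

text \<open>
  Multiplication by a monomial shifts the support, which makes colon ideals by monomials a matter
  of exponents.
\<close>

lemma lookup_times_single:
  fixes p :: "('v, 'k::field) mpoly"
  shows "Poly_Mapping.lookup (p * Poly_Mapping.single t 1) (s + t) = Poly_Mapping.lookup p s"
proof -
  have "p * Poly_Mapping.single t 1
      = (\<Sum>u\<in>Poly_Mapping.keys p. Poly_Mapping.single (u + t) (Poly_Mapping.lookup p u))"
    by (subst sum_single[of p]) (simp add: sum_distrib_right mult_single)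
  then show ?thesis
    by (simp add: lookup_sum lookup_single when_def in_keys_iff)
qed

lemma ideal_colon_mono:
  "ideal_colon (mono_ideal U) (Poly_Mapping.single t 1) =
    (mono_ideal {s. s + t \<in> U} :: ('a, 'b::field) mpoly set)" (is "?C = ?M")
proof
  show "?C \<subseteq> ?M"
  proof
    fix p :: "('a, 'b) mpoly" assume p: "p \<in> ideal_colon (mono_ideal U) (Poly_Mapping.single t 1)"
    have "s + t \<in> U" if "s \<in> Poly_Mapping.keys p" for s
      using that p lookup_times_single[of p t s]
      by (auto simp: ideal_colon_def mono_ideal_def in_keys_iff)
    then show "p \<in> mono_ideal {s. s + t \<in> U}" by (auto simp: mono_ideal_def)
  qed
  show "?M \<subseteq> ?C"
  proof
    fix p :: "('a, 'b) mpoly" assume "p \<in> mono_ideal {s. s + t \<in> U}"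
    then show "p \<in> ideal_colon (mono_ideal U) (Poly_Mapping.single t 1)"
      using keys_mult[of p "Poly_Mapping.single t 1"]
      by (auto simp: ideal_colon_def mono_ideal_def)
  qed
qed

definition sumset :: "('v \<Rightarrow>\<^sub>0 nat) set \<Rightarrow> ('v \<Rightarrow>\<^sub>0 nat) set \<Rightarrow> ('v \<Rightarrow>\<^sub>0 nat) set" where
  "sumset S T = {s + t | s t. s \<in> S \<and> t \<in> T}"

lemma ideal_prod_mono:
  "ideal_prod (mono_ideal (up_closure S)) (mono_ideal (up_closure T)) =
    (mono_ideal (up_closure (sumset S T)) :: ('v, 'k::field) mpoly set)"
proof
  have "a * b \<in> mono_ideal (up_closure (sumset S T))"
    if a: "a \<in> mono_ideal (up_closure S)" and b: "b \<in> mono_ideal (up_closure T)" for a b :: "('v, 'k) mpoly"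
    unfolding mono_ideal_def mem_Collect_eq
  proof
    fix k assume "k \<in> Poly_Mapping.keys (a * b)"
    then obtain x y where "k = x + y" "x \<in> Poly_Mapping.keys a" "y \<in> Poly_Mapping.keys b"
      using keys_mult by blast
    moreover from this have "x \<in> up_closure S" "y \<in> up_closure T"
      using a b by (auto simp: mono_ideal_def)
    ultimately obtain s u t w where "k = (s + u) + (t + w)" "s \<in> S" "t \<in> T"
      by (auto simp: up_closure_def)
    then have "k = (s + t) + (u + w)" "s + t \<in> sumset S T"
      by (auto simp: algebra_simps sumset_def)
    then show "k \<in> up_closure (sumset S T)" unfolding up_closure_def by blast
  qed
  then show "ideal_prod (mono_ideal (up_closure S)) (mono_ideal (up_closure T)) \<subseteq>
      (mono_ideal (up_closure (sumset S T)) :: ('v, 'k) mpoly set)"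
    unfolding ideal_prod_def ideal_gen_def
    by (intro module.span_minimal[OF ring_module] subspace_mono_ideal up_closure_add) auto
  have gens: "Poly_Mapping.single s (1::'k) \<in> mono_ideal (up_closure S)" if "s \<in> S" for s :: "'v \<Rightarrow>\<^sub>0 nat" and S
    using that subset_up_closure[of S] by (auto simp: mono_ideal_def)
  have "(\<lambda>s. Poly_Mapping.single s (1::'k)) ` sumset S T \<subseteq>
      {a * b | a b. a \<in> mono_ideal (up_closure S) \<and> b \<in> mono_ideal (up_closure T)}"
  proof (intro image_subsetI)
    fix k assume "k \<in> sumset S T"
    then obtain s t where st: "k = s + t" "s \<in> S" "t \<in> T" by (auto simp: sumset_def)
    have "Poly_Mapping.single k (1::'k) = Poly_Mapping.single s 1 * Poly_Mapping.single t 1"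
      by (simp add: mult_single st(1))
    with st(2,3) gens show "Poly_Mapping.single k (1::'k) \<in>
        {a * b | a b. a \<in> mono_ideal (up_closure S) \<and> b \<in> mono_ideal (up_closure T)}" by blast
  qed
  then have "ideal_gen ((\<lambda>s. Poly_Mapping.single s (1::'k)) ` sumset S T) \<subseteq>
      ideal_prod (mono_ideal (up_closure S)) (mono_ideal (up_closure T))"
    unfolding ideal_prod_def ideal_gen_def by (rule module.span_mono[OF ring_module])
  then show "mono_ideal (up_closure (sumset S T)) \<subseteq>
      ideal_prod (mono_ideal (up_closure S)) (mono_ideal (up_closure T) :: ('v, 'k) mpoly set)"
    by (simp add: ideal_gen_monomials)
qed


section \<open>Powers of facet ideals\<close>

definition face_exp :: "'v::finite set \<Rightarrow> ('v \<Rightarrow>\<^sub>0 nat)" where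
  "face_exp G = (\<Sum>v\<in>G. Poly_Mapping.single v 1)"

lemma lookup_face_exp: "Poly_Mapping.lookup (face_exp G) v = (if v \<in> G then 1 else 0)"
  by (simp add: face_exp_def lookup_sum lookup_single when_def)

lemma prod_var: "(\<Prod>v\<in>G. var v) = (Poly_Mapping.single (face_exp G) 1 :: ('v::finite, 'k::field) mpoly)"
proof -
  have "finite G" by simp
  then show ?thesis
    by (induction G rule: finite_induct) (simp_all add: face_exp_def var_def mult_single)
qed

text \<open>The exponents of the products of \<open>n\<close> facet monomials.\<close>

definition facet_sums :: "'v::finite set set \<Rightarrow> nat \<Rightarrow> ('v \<Rightarrow>\<^sub>0 nat) set" where
  "facet_sums S n = {sum_list (map face_exp Fs) | Fs. set Fs \<subseteq> S \<and> length Fs = n}"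

lemma facet_sums_0 [simp]: "facet_sums S 0 = {0}"
  by (auto simp: facet_sums_def)

lemma facet_sums_Suc: "facet_sums S (Suc n) = sumset (face_exp ` S) (facet_sums S n)"
proof (intro equalityI subsetI)
  fix t assume "t \<in> facet_sums S (Suc n)"
  then obtain F Fs where "t = face_exp F + sum_list (map face_exp Fs)" "F \<in> S" "set Fs \<subseteq> S" "length Fs = n"
    by (auto simp: facet_sums_def length_Suc_conv)
  then show "t \<in> sumset (face_exp ` S) (facet_sums S n)"
    unfolding sumset_def facet_sums_def by blast
next
  fix t assume "t \<in> sumset (face_exp ` S) (facet_sums S n)"
  then obtain F Fs where F: "t = face_exp F + sum_list (map face_exp Fs)" "F \<in> S" "set Fs \<subseteq> S" "length Fs = n"
    by (auto simp: sumset_def facet_sums_def)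
  then show "t \<in> facet_sums S (Suc n)"
    unfolding facet_sums_def by (intro CollectI exI[of _ "F # Fs"]) simp
qed

lemma ideal_gen_face_exp:
  "ideal_gen ((\<lambda>G. Poly_Mapping.single (face_exp G) (1::'k::field)) ` S) = mono_ideal (up_closure (face_exp ` S))"
  using ideal_gen_monomials[where 'k = 'k, of "face_exp ` S"] by (simp add: image_image)

lemma facet_ideal_mono: "facet_ideal \<Delta> = mono_ideal (up_closure (face_exp ` facets \<Delta>))"
  unfolding facet_ideal_def face_monomial_def prod_var ideal_gen_face_exp ..

text \<open>
  The monomials in a power of the facet ideal are the multiples of the products of facet monomials.
\<close>

lemma facet_ideal_power:
  "ideal_power (facet_ideal \<Delta>) n = mono_ideal (up_closure (facet_sums (facets \<Delta>) n))"
  by (induction n) (simp_all add: facet_sums_Suc facet_ideal_mono ideal_prod_mono)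

text \<open>
  The exponent of a variable in such a product counts the facets through the vertex.
\<close>

lemma lookup_sum_list_face_exp:
  "Poly_Mapping.lookup (sum_list (map face_exp Fs)) v = length (filter (\<lambda>F. v \<in> F) Fs)"
  by (induction Fs) (simp_all add: lookup_add lookup_face_exp)

lemma chain_has_greatest:
  assumes "finite A" "A \<noteq> {}" "\<And>x y. x \<in> A \<Longrightarrow> y \<in> A \<Longrightarrow> f x \<subseteq> f y \<or> f y \<subseteq> f x"
  shows "\<exists>x\<in>A. \<forall>y\<in>A. f y \<subseteq> f x"
  using assms
proof (induction A rule: finite_ne_induct)
  case (insert a A)
  then obtain x where x: "x \<in> A" "\<forall>y\<in>A. f y \<subseteq> f x" by blast
  show ?case
  proof (cases "f a \<subseteq> f x")
    case False
    then have "f x \<subseteq> f a" using insert.prems[of x a] x(1) by blast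
    with x(2) show ?thesis by (intro bexI[of _ a]) auto
  qed (use x in blast)
qed simp

text \<open>
  The description of a good leaf by the traces of the facets on it; for a single facet it holds
  trivially.
\<close>

definition good_facet :: "'v set set \<Rightarrow> 'v set \<Rightarrow> bool" where
  "good_facet S G \<longleftrightarrow> G \<in> S \<and> (\<forall>H\<in>S. \<forall>H'\<in>S. H \<inter> G \<subseteq> H' \<inter> G \<or> H' \<inter> G \<subseteq> H \<inter> G)"

text \<open>
  Let the product of the facets in \<open>Fs\<close> divide \<open>t m\<^sub>G\<close>, and let \<open>H\<close> have the largest trace on \<open>G\<close>
  among them. Omitting \<open>H\<close> leaves a divisor of \<open>t\<close>: only exponents at vertices of \<open>G\<close> have to drop,
  namely by one; they do so on \<open>H\<close>, and at a vertex of \<open>G\<close> outside \<open>H\<close> no facet of \<open>Fs\<close> passes. If \<open>G\<close>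
  itself belongs to \<open>Fs\<close>, it has the largest trace and this is plain cancellation.
\<close>

theorem facet_power_colon:
  assumes "good_facet S G"
  shows "t + face_exp G \<in> up_closure (facet_sums S (Suc n)) \<longleftrightarrow> t \<in> up_closure (facet_sums S n)"
proof
  assume "t \<in> up_closure (facet_sums S n)"
  then obtain s u where t: "t = s + u" "s \<in> facet_sums S n" by (auto simp: up_closure_def)
  have "face_exp G + s \<in> facet_sums S (Suc n)"
    using t(2) assms by (auto simp: facet_sums_Suc sumset_def good_facet_def)
  then show "t + face_exp G \<in> up_closure (facet_sums S (Suc n))"
    unfolding up_closure_def by (intro CollectI exI[of _ "face_exp G + s"] exI[of _ u]) (simp add: t(1) algebra_simps)
next
  assume "t + face_exp G \<in> up_closure (facet_sums S (Suc n))"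
  then obtain Fs where Fs: "set Fs \<subseteq> S" "length Fs = Suc n"
    and le: "\<And>v. length (filter (\<lambda>F. v \<in> F) Fs) \<le> Poly_Mapping.lookup t v + (if v \<in> G then 1 else 0)"
    unfolding up_closure_iff facet_sums_def
    by (auto simp: lookup_sum_list_face_exp lookup_add lookup_face_exp)
  have "\<exists>H\<in>set Fs. \<forall>H'\<in>set Fs. H' \<inter> G \<subseteq> H \<inter> G"
    using Fs assms by (intro chain_has_greatest) (auto simp: good_facet_def)
  then obtain H where H: "H \<in> set Fs" "\<And>H'. H' \<in> set Fs \<Longrightarrow> H' \<inter> G \<subseteq> H \<inter> G" by blast
  have "length (filter (\<lambda>F. v \<in> F) (remove1 H Fs)) \<le> Poly_Mapping.lookup t v" for v
  proof (cases "v \<in> H")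
    case True
    have "length (filter (\<lambda>F. v \<in> F) (remove1 H Fs)) = length (filter (\<lambda>F. v \<in> F) Fs) - 1"
      using H(1) True by (simp add: filter_remove1 length_remove1)
    with le[of v] show ?thesis by (simp split: if_splits)
  next
    case False
    then have eq: "length (filter (\<lambda>F. v \<in> F) (remove1 H Fs)) = length (filter (\<lambda>F. v \<in> F) Fs)"
      by (simp add: filter_remove1 remove1_idem)
    show ?thesis
    proof (cases "v \<in> G")
      case True
      then have "filter (\<lambda>F. v \<in> F) Fs = []"
        using H(2) False by (auto simp: filter_empty_conv)
      then show ?thesis using eq by simp
    next
      case False
      then show ?thesis using eq le[of v] by simp
    qed
  qed
  moreover have "sum_list (map face_exp (remove1 H Fs)) \<in> facet_sums S n"
    using Fs H(1) set_remove1_subset[of H Fs]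
    by (auto simp: facet_sums_def length_remove1 intro!: exI[of _ "remove1 H Fs"])
  ultimately show "t \<in> up_closure (facet_sums S n)"
    unfolding up_closure_iff by (intro bexI) (auto simp: lookup_sum_list_face_exp)
qed

text \<open>
  A product of facet monomials that involves \<open>G\<close> is already a multiple of the monomial of \<open>G\<close>.
\<close>

lemma facet_power_insert:
  "up_closure (facet_sums (insert G S) (Suc n)) \<union> up_closure {face_exp G} =
    up_closure (facet_sums S (Suc n)) \<union> up_closure {face_exp G}"
proof -
  have "t \<in> up_closure (facet_sums S (Suc n)) \<union> up_closure {face_exp G}"
    if "t \<in> up_closure (facet_sums (insert G S) (Suc n))" for t
  proof -
    obtain Fs where Fs: "set Fs \<subseteq> insert G S" "length Fs = Suc n"
      and le: "\<And>v. Poly_Mapping.lookup (sum_list (map face_exp Fs)) v \<le> Poly_Mapping.lookup t v"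
      using \<open>t \<in> up_closure (facet_sums (insert G S) (Suc n))\<close>
      unfolding up_closure_iff facet_sums_def by blast
    show ?thesis
    proof (cases "G \<in> set Fs")
      case True
      have "Poly_Mapping.lookup (face_exp G) v \<le> Poly_Mapping.lookup t v" for v
      proof -
        have "1 \<le> length (filter (\<lambda>F. v \<in> F) Fs)" if "v \<in> G"
          using True that by (auto simp: Suc_le_eq filter_empty_conv)
        with le[of v] show ?thesis
          unfolding lookup_sum_list_face_exp lookup_face_exp by (auto intro: order_trans)
      qed
      then show ?thesis by (simp add: up_closure_iff)
    next
      case False
      then have "sum_list (map face_exp Fs) \<in> facet_sums S (Suc n)"
        using Fs by (auto simp: facet_sums_def)
      then show ?thesis using le by (auto simp: up_closure_iff)
    qed
  qed
  moreover have "facet_sums S (Suc n) \<subseteq> facet_sums (insert G S) (Suc n)"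
    by (auto simp: facet_sums_def)
  then have "up_closure (facet_sums S (Suc n)) \<subseteq> up_closure (facet_sums (insert G S) (Suc n))"
    by (auto simp: up_closure_def)
  ultimately show ?thesis by blast
qed


section \<open>Good leaves\<close>

lemma facets_generated:
  assumes "\<And>G H. G \<in> S \<Longrightarrow> H \<in> S \<Longrightarrow> G \<subseteq> H \<Longrightarrow> G = H"
  shows "facets (generated S) = S"
proof
  show "facets (generated S) \<subseteq> S"
    unfolding facets_def generated_def by blast
  show "S \<subseteq> facets (generated S)"
  proof
    fix G assume G: "G \<in> S"
    have "G = H" if "H \<in> generated S" "G \<subseteq> H" for H
    proof -
      obtain H' where "H' \<in> S" "H \<subseteq> H'" using \<open>H \<in> generated S\<close> by (auto simp: generated_def)
      with assms[OF G] that(2) show ?thesis by blast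
    qed
    with G show "G \<in> facets (generated S)" by (auto simp: facets_def generated_def)
  qed
qed

lemma facets_antichain: "G \<in> facets \<Delta> \<Longrightarrow> H \<in> facets \<Delta> \<Longrightarrow> G \<subseteq> H \<Longrightarrow> G = H"
  by (auto simp: facets_def)

text \<open>
  Two traces are compared by means of the subcomplex generated by the two facets and the leaf.
\<close>

lemma good_facet_of_good_leaf:
  assumes "good_leaf \<Delta> G"
  shows "good_facet (facets \<Delta>) G"
  unfolding good_facet_def
proof (intro conjI ballI)
  show G: "G \<in> facets \<Delta>" using assms by (simp add: good_leaf_def)
  fix H H' assume H: "H \<in> facets \<Delta>" and H': "H' \<in> facets \<Delta>"
  show "H \<inter> G \<subseteq> H' \<inter> G \<or> H' \<inter> G \<subseteq> H \<inter> G"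
  proof (cases "H = G \<or> H' = G")
    case False
    let ?S = "{G, H, H'}"
    have "facets (generated ?S) = ?S"
      using G H H' by (intro facets_generated) (auto dest: facets_antichain)
    moreover have "leaf (generated ?S) G"
      using assms G H H' by (auto simp: good_leaf_def)
    ultimately obtain X where "X \<in> ?S" "X \<noteq> G" "\<forall>Y\<in>?S. Y \<noteq> G \<longrightarrow> Y \<inter> G \<subseteq> X \<inter> G"
      using False unfolding leaf_def by auto
    then show ?thesis using False by auto
  qed auto
qed


section \<open>The inequality for powers of facet ideals\<close>

lemma homogeneous_mono_ideal:
  assumes "\<And>t u. t \<in> U \<Longrightarrow> t + u \<in> U"
  shows "homogeneous_ideal (mono_ideal U)"
  unfolding homogeneous_ideal_def
  by (intro conjI subspace_mono_ideal assms)
    (auto simp: mono_ideal_def in_keys_iff lookup_hcomp split: if_splits)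

lemma reg_quot_mono_ideal:
  fixes S :: "('v::finite \<Rightarrow>\<^sub>0 nat) set"
  defines "I \<equiv> \<lambda>U. mono_ideal U :: ('v, 'k::field) mpoly set"
  shows "reg_quot (I (up_closure S)) \<le> max
    (ereal (real (mon_deg g)) + reg_quot (I {t. t + g \<in> up_closure S}))
    (reg_quot (I (up_closure S \<union> up_closure {g})))"
proof -
  let ?m = "Poly_Mapping.single g 1 :: ('v, 'k) mpoly"
  have "hcomp (mon_deg g) ?m = ?m"
    by (rule poly_mapping_eqI) (auto simp: lookup_hcomp lookup_single when_def)
  from reg_quot_le_colon_sum[OF homogeneous_mono_ideal[OF up_closure_add[of _ S]] this]
  show ?thesis
    using ideal_gen_monomials[where 'k = 'k, of "{g}"]
    by (simp add: I_def ideal_colon_mono ideal_sum_mono)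
qed

theorem theorem4p3:
  fixes \<Delta> :: "'v::finite set set" and r s :: nat and F :: "nat \<Rightarrow> 'v set"
    and m :: "nat \<Rightarrow> ('v, 'k::field) mpoly" and d :: "nat \<Rightarrow> nat"
    and \<Delta>' :: "nat \<Rightarrow> 'v set set" and J :: "nat \<Rightarrow> ('v, 'k) mpoly set"
  assumes "simplicial_forest \<Delta>"
    and "good_leaf_ordering \<Delta> r F"
    and "\<And>i. i \<in> {1..r} \<Longrightarrow> m i = (\<Prod>j\<in>F i. var j)"
    and "\<And>i. i \<in> {1..r} \<Longrightarrow> d i = total_degree (m i)"
    and "\<And>i. i \<in> {1..<r} \<Longrightarrow> \<Delta>' i = generated (F ` {1..i})"
    and "\<And>i. i \<in> {1..<r} \<Longrightarrow> J i = ideal_gen (m ` {i+1..r})"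
    and "s \<ge> 1"
  shows "reg_quot (ideal_power (facet_ideal \<Delta> :: ('v, 'k) mpoly set) (s + 1)) \<le>
    Max ({ereal (real (d r)) + reg_quot (ideal_power (facet_ideal \<Delta> :: ('v, 'k) mpoly set) s)} \<union>
         (\<lambda>i. ereal (real (d i)) +
               reg_quot (ideal_sum (ideal_power (facet_ideal (\<Delta>' i)) s) (ideal_colon (J i) (m i))))
           ` {1..<r} \<union>
         {reg_quot (facet_ideal \<Delta> :: ('v, 'k) mpoly set)})"
    (is "_ \<le> Max ?X")
proof -
  let ?I = "\<lambda>U. mono_ideal U :: ('v, 'k) mpoly set"
  define S where "S i = F ` {1..i}" for i
  define T where "T i = F ` {i+1..r}" for i
  \<comment> \<open>\<open>U i\<close> consists of the exponents of the monomials in \<open>I(\<Delta>\<^sub>i)^(s+1) + J\<^sub>i\<close>, including \<open>i = 0\<close> and \<open>i = r\<close>.\<close>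
  define U where "U i = up_closure (facet_sums (S i) (Suc s) \<union> face_exp ` T i)" for i
  have facets: "facets \<Delta> = S r" and inj: "inj_on F {1..r}"
    using assms(2) by (auto simp: good_leaf_ordering_def bij_betw_def S_def)
  have nz: "Poly_Mapping.single t 1 \<noteq> (0 :: ('v, 'k) mpoly)" for t
    by (metis lookup_single_eq lookup_zero zero_neq_one)
  have m: "m i = Poly_Mapping.single (face_exp (F i)) 1" and d: "d i = mon_deg (face_exp (F i))"
    if "i \<in> {1..r}" for i
    using assms(3,4)[OF that] by (simp_all add: prod_var total_degree_def nz)
  have facets_gen: "facets (generated (S i)) = S i" if "i \<le> r" for i
  proof (rule facets_generated)
    have "S i \<subseteq> S r" using that unfolding S_def by (intro image_mono) simp
    then show "G = H" if "G \<in> S i" "H \<in> S i" "G \<subseteq> H" for G H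
      using facets_antichain[of G \<Delta> H] that by (auto simp: facets)
  qed
  have good: "good_facet (S i) (F i)" if "i \<in> {1..r}" for i
  proof (cases "i = 1")
    case True
    then show ?thesis by (simp add: good_facet_def S_def)
  next
    case False
    then have "good_leaf (generated (S i)) (F i)"
      using assms(2) that by (simp add: good_leaf_ordering_def S_def)
    from good_facet_of_good_leaf[OF this] facets_gen[of i] that show ?thesis by simp
  qed
  have colon: "{t. t + face_exp (F i) \<in> U i} = up_closure (facet_sums (S i) s)
      \<union> {t. t + face_exp (F i) \<in> up_closure (face_exp ` T i)}" if "i \<in> {1..r}" for i
    using facet_power_colon[OF good[OF that], of _ s] by (auto simp: U_def up_closure_Un)
  have drop: "U (Suc i) \<union> up_closure {face_exp (F (Suc i))} = U i" if "Suc i \<le> r" for i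
  proof -
    have S_Suc: "S (Suc i) = insert (F (Suc i)) (S i)"
      unfolding S_def by (simp add: atLeastAtMostSuc_conv)
    have "T i = insert (F (Suc i)) (T (Suc i))"
      using that unfolding T_def by (simp add: Icc_eq_insert_lb_nat)
    then have T_Suc: "face_exp ` T i = {face_exp (F (Suc i))} \<union> face_exp ` T (Suc i)" by simp
    show ?thesis
      unfolding U_def S_Suc T_Suc up_closure_Un
      using facet_power_insert[of "F (Suc i)" "S i" s] by blast
  qed
  have "reg_quot (?I (U i)) \<le> Max ?X" if "i \<le> r" for i
    using that
  proof (induction i)
    case 0
    have "U 0 = up_closure (face_exp ` facets \<Delta>)"
      by (simp add: U_def S_def T_def facets facet_sums_Suc sumset_def)
    then have "reg_quot (?I (U 0)) \<in> ?X" by (simp add: facet_ideal_mono)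
    then show ?case by (intro Max_ge) auto
  next
    case (Suc i)
    let ?j = "Suc i"
    let ?Q = "?I {t. t + face_exp (F ?j) \<in> U ?j}"
    have j: "?j \<in> {1..r}" using Suc.prems by simp
    have "ereal (real (d ?j)) + reg_quot ?Q \<in> ?X"
    proof (cases "?j = r")
      case True
      then have "T ?j = {}" by (simp add: T_def)
      then have "?Q = ideal_power (facet_ideal \<Delta>) s"
        unfolding colon[OF j] facet_ideal_power facets using True by simp
      then show ?thesis using True by simp
    next
      case False
      then have j': "?j \<in> {1..<r}" using j by simp
      have "J ?j = ideal_gen ((\<lambda>G. Poly_Mapping.single (face_exp G) 1) ` T ?j)"
        unfolding assms(6)[OF j'] T_def image_image
        by (intro arg_cong[of _ _ ideal_gen] image_cong refl m) simp
      then have J: "ideal_colon (J ?j) (m ?j)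
          = ?I {t. t + face_exp (F ?j) \<in> up_closure (face_exp ` T ?j)}"
        by (simp add: ideal_gen_face_exp m[OF j] ideal_colon_mono)
      have "ideal_power (facet_ideal (\<Delta>' ?j)) s = ?I (up_closure (facet_sums (S ?j) s))"
        using facets_gen[OF Suc.prems] assms(5)[OF j'] by (simp add: facet_ideal_power S_def)
      then have "?Q = ideal_sum (ideal_power (facet_ideal (\<Delta>' ?j)) s) (ideal_colon (J ?j) (m ?j))"
        by (simp only: J ideal_sum_mono colon[OF j])
      then show ?thesis using j' by auto
    qed
    then have colon_le: "ereal (real (d ?j)) + reg_quot ?Q \<le> Max ?X"
      by (intro Max_ge) auto
    have sum_le: "reg_quot (?I (U i)) \<le> Max ?X"
      using Suc by simp
    have "reg_quot (?I (U ?j)) \<le>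
        max (ereal (real (d ?j)) + reg_quot ?Q) (reg_quot (?I (U i)))"
      using reg_quot_mono_ideal[where 'k = 'k, of "facet_sums (S ?j) (Suc s) \<union> face_exp ` T ?j" "face_exp (F ?j)"]
      unfolding U_def[of ?j, symmetric] drop[OF Suc.prems] d[OF j] .
    also have "\<dots> \<le> Max ?X"
      using colon_le sum_le by (rule max.boundedI)
    finally show ?case .
  qed
  from this[of r] have "reg_quot (?I (U r)) \<le> Max ?X" by simp
  moreover have "?I (U r) = ideal_power (facet_ideal \<Delta>) (s + 1)"
    unfolding facet_ideal_power facets by (simp add: U_def T_def)
  ultimately show ?thesis by simp
qed

end
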